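(* Let $A$ be a higher Auslander algebra (finite-dimensional over a field) of global dimension $g$. Then every non-zero torsion $A$-module has projective dimension equal to $g$.
   Context: A finite-dimensional algebra $A$ is called a higher Auslander algebra if $\operatorname{gldim}A\le n\le \operatorname{domdim}A$ for some $n\ge 2$. For an $A$-module $M$ with minimal injective coresolution $0\to M\to I_0\to I_1\to\cdots$, the dominant dimension of $M$ is $n$ if $I_0,\dots,I_{n-1}$ are projective and $I_n$ is not, and it is infinite if all $I_i$ are projective; $\operatorname{domdim}A$ is the dominant dimension of the regular module $A$. Write $(-)^*=\operatorname{Hom}_A(-,A)$. For a finitely generated left $A$-module $M$, $f_M:M\to M^{**}$ is the canonical evaluation map, $f_M(m)(f)=f(m)$ for $f\in M^*$, and $t(M):=\ker f_M$. Torsion modules are the modules of the form $t(M)$ for some finitely generated left $A$-module $M$. *)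

theory Defs
  imports "HOL-Algebra.Embedded_Algebras" "HOL-Algebra.Module" "HOL-Library.Extended_Nat"
begin

section \<open>Modules over a noncommutative ring\<close>

text \<open>The library locale \<^locale>\<open>module\<close> requires a commutative ring. Here its axioms are
  imposed over an arbitrary ring; the record type and \<^locale>\<open>submodule\<close> (which does
  not assume commutativity) are the library's.\<close>

locale left_module = R?: ring R + M?: abelian_group M
  for R :: "('a, 'r) ring_scheme" (structure) and M :: "('a, 'm, 'x) module_scheme" (structure) +
  assumes smult_closed:
      "\<lbrakk>a \<in> carrier R; x \<in> carrier M\<rbrakk> \<Longrightarrow> a \<odot>\<^bsub>M\<^esub> x \<in> carrier M"
    and smult_l_distr:
      "\<lbrakk>a \<in> carrier R; b \<in> carrier R; x \<in> carrier M\<rbrakk> \<Longrightarrow>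
        (a \<oplus> b) \<odot>\<^bsub>M\<^esub> x = a \<odot>\<^bsub>M\<^esub> x \<oplus>\<^bsub>M\<^esub> b \<odot>\<^bsub>M\<^esub> x"
    and smult_r_distr:
      "\<lbrakk>a \<in> carrier R; x \<in> carrier M; y \<in> carrier M\<rbrakk> \<Longrightarrow>
        a \<odot>\<^bsub>M\<^esub> (x \<oplus>\<^bsub>M\<^esub> y) = a \<odot>\<^bsub>M\<^esub> x \<oplus>\<^bsub>M\<^esub> a \<odot>\<^bsub>M\<^esub> y"
    and smult_assoc1:
      "\<lbrakk>a \<in> carrier R; b \<in> carrier R; x \<in> carrier M\<rbrakk> \<Longrightarrow>
        (a \<otimes> b) \<odot>\<^bsub>M\<^esub> x = a \<odot>\<^bsub>M\<^esub> (b \<odot>\<^bsub>M\<^esub> x)"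
    and smult_one:
      "x \<in> carrier M \<Longrightarrow> \<one> \<odot>\<^bsub>M\<^esub> x = x"

definition left_module_hom ::
  "('a, 'r) ring_scheme \<Rightarrow> ('a, 'm) module \<Rightarrow> ('a, 'n) module \<Rightarrow> ('m \<Rightarrow> 'n) set" where
  "left_module_hom A M N =
     {f \<in> carrier M \<rightarrow> carrier N.
        (\<forall>x\<in>carrier M. \<forall>y\<in>carrier M. f (x \<oplus>\<^bsub>M\<^esub> y) = f x \<oplus>\<^bsub>N\<^esub> f y) \<and>
        (\<forall>a\<in>carrier A. \<forall>x\<in>carrier M. f (a \<odot>\<^bsub>M\<^esub> x) = a \<odot>\<^bsub>N\<^esub> f x)}"

definition left_module_isomorphic ::
  "('a, 'r) ring_scheme \<Rightarrow> ('a, 'm) module \<Rightarrow> ('a, 'n) module \<Rightarrow> bool" where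
  "left_module_isomorphic A M N \<longleftrightarrow>
     (\<exists>f\<in>left_module_hom A M N. bij_betw f (carrier M) (carrier N))"

definition fg_left_module :: "('a, 'r) ring_scheme \<Rightarrow> ('a, 'm) module \<Rightarrow> bool" where
  "fg_left_module A M \<longleftrightarrow> left_module A M \<and>
     (\<exists>S. finite S \<and> S \<subseteq> carrier M \<and>
        (\<forall>H. submodule H A M \<and> S \<subseteq> H \<longrightarrow> H = carrier M))"

text \<open>The ring multiplication and unit fields of a module record carry no meaning.\<close>

definition regular_module :: "('a, 'r) ring_scheme \<Rightarrow> ('a, 'a) module" where
  "regular_module A =
     \<lparr>carrier = carrier A, mult = undefined, one = undefined,
      zero = \<zero>\<^bsub>A\<^esub>, add = (\<oplus>\<^bsub>A\<^esub>), smult = (\<otimes>\<^bsub>A\<^esub>)\<rparr>"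


section \<open>Finite-dimensional algebras\<close>

text \<open>The ground field is identified with its image in the centre of \<open>A\<close>. This excludes only
  the zero algebra, which has no non-zero modules.\<close>

locale finite_dimensional_algebra = ring A for K and A (structure) +
  assumes subfield: "subfield K A"
    and central: "\<lbrakk>c \<in> K; a \<in> carrier A\<rbrakk> \<Longrightarrow> c \<otimes> a = a \<otimes> c"
    and finite_dimensional: "finite_dimension K (carrier A)"

text \<open>HOL cannot quantify over all modules on all types, so quantification over modules
  uses modules whose carrier is any subset of \<open>nat \<Rightarrow> 'a\<close>, where \<open>'a\<close> is the type of elements
  of \<open>A\<close>. Up to isomorphism these include all finitely generated \<open>A\<close>-modules: such a module
  is a finite-dimensional \<open>K\<close>-vector space, so its structure can be transported
  to some \<open>K^n\<close>. They also include every left ideal of \<open>A\<close> and a free cover of each of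
  them (its cardinality does not exceed that of \<open>nat \<Rightarrow> 'a\<close>), so
  the lifting and extension properties below are the usual
  projectivity and, by Baer's criterion, the usual injectivity.\<close>

type_synonym 'a umodule = "('a, nat \<Rightarrow> 'a) module"

definition projective_module :: "('a, 'r) ring_scheme \<Rightarrow> 'a umodule \<Rightarrow> bool" where
  "projective_module A P \<longleftrightarrow> left_module A P \<and>
     (\<forall>(V :: 'a umodule) (W :: 'a umodule) g f.
        left_module A V \<and> left_module A W \<and>
        g \<in> left_module_hom A V W \<and> g ` carrier V = carrier W \<and>
        f \<in> left_module_hom A P W \<longrightarrow>
        (\<exists>h\<in>left_module_hom A P V. \<forall>p\<in>carrier P. g (h p) = f p))"

definition injective_module :: "('a, 'r) ring_scheme \<Rightarrow> 'a umodule \<Rightarrow> bool" where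
  "injective_module A I \<longleftrightarrow> left_module A I \<and>
     (\<forall>(V :: 'a umodule) (W :: 'a umodule) g f.
        left_module A V \<and> left_module A W \<and>
        g \<in> left_module_hom A V W \<and> inj_on g (carrier V) \<and>
        f \<in> left_module_hom A V I \<longrightarrow>
        (\<exists>h\<in>left_module_hom A W I. \<forall>x\<in>carrier V. h (g x) = f x))"


section \<open>Homological dimensions\<close>

text \<open>Everything takes place in the category of finitely generated modules:
  \<open>\<dots> \<rightarrow> P 2 \<rightarrow> P 1 \<rightarrow> P 0 \<rightarrow> M \<rightarrow> 0\<close> with augmentation \<open>e\<close> and \<open>d i : P (i+1) \<rightarrow> P i\<close>.\<close>

definition projective_resolution ::
  "('a, 'r) ring_scheme \<Rightarrow> ('a, 'm) module \<Rightarrow> (nat \<Rightarrow> 'a umodule) \<Rightarrow>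
     (nat \<Rightarrow> (nat \<Rightarrow> 'a) \<Rightarrow> (nat \<Rightarrow> 'a)) \<Rightarrow> ((nat \<Rightarrow> 'a) \<Rightarrow> 'm) \<Rightarrow> bool" where
  "projective_resolution A M P d e \<longleftrightarrow>
     (\<forall>i. fg_left_module A (P i) \<and> projective_module A (P i)) \<and>
     e \<in> left_module_hom A (P 0) M \<and>
     (\<forall>i. d i \<in> left_module_hom A (P (Suc i)) (P i)) \<and>
     e ` carrier (P 0) = carrier M \<and>
     d 0 ` carrier (P 1) = a_kernel (P 0) M e \<and>
     (\<forall>i. d (Suc i) ` carrier (P (Suc (Suc i))) = a_kernel (P (Suc i)) (P i) (d i))"

text \<open>The infimum of the empty set is \<open>\<infinity>\<close>; the zero module gets projective dimension 0.\<close>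

definition projective_dimension ::
  "('a, 'r) ring_scheme \<Rightarrow> ('a, 'm) module \<Rightarrow> enat" where
  "projective_dimension A M =
     Inf {enat n | n. \<exists>P d e. projective_resolution A M P d e \<and>
                        (\<forall>i>n. carrier (P i) = {\<zero>\<^bsub>P i\<^esub>})}"

definition global_dimension :: "('a, 'r) ring_scheme \<Rightarrow> enat" where
  "global_dimension A =
     Sup {projective_dimension A M | M :: 'a umodule. fg_left_module A M}"

definition essential_submodule ::
  "('a, 'r) ring_scheme \<Rightarrow> 'm set \<Rightarrow> ('a, 'm) module \<Rightarrow> bool" where
  "essential_submodule A H M \<longleftrightarrow> submodule H A M \<and>
     (\<forall>L. submodule L A M \<and> L \<noteq> {\<zero>\<^bsub>M\<^esub>} \<longrightarrow> H \<inter> L \<noteq> {\<zero>\<^bsub>M\<^esub>})"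

text \<open>\<open>0 \<rightarrow> M \<rightarrow> I 0 \<rightarrow> I 1 \<rightarrow> \<dots>\<close> with \<open>e : M \<rightarrow> I 0\<close> and \<open>d i : I i \<rightarrow> I (i+1)\<close>. Minimality:
  each term is an injective envelope of the image of the map into it.\<close>

definition minimal_injective_coresolution ::
  "('a, 'r) ring_scheme \<Rightarrow> ('a, 'm) module \<Rightarrow> (nat \<Rightarrow> 'a umodule) \<Rightarrow>
     (nat \<Rightarrow> (nat \<Rightarrow> 'a) \<Rightarrow> (nat \<Rightarrow> 'a)) \<Rightarrow> ('m \<Rightarrow> (nat \<Rightarrow> 'a)) \<Rightarrow> bool" where
  "minimal_injective_coresolution A M I d e \<longleftrightarrow>
     (\<forall>i. fg_left_module A (I i) \<and> injective_module A (I i)) \<and>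
     e \<in> left_module_hom A M (I 0) \<and>
     (\<forall>i. d i \<in> left_module_hom A (I i) (I (Suc i))) \<and>
     inj_on e (carrier M) \<and>
     e ` carrier M = a_kernel (I 0) (I 1) (d 0) \<and>
     (\<forall>i. d i ` carrier (I i) = a_kernel (I (Suc i)) (I (Suc (Suc i))) (d (Suc i))) \<and>
     essential_submodule A (e ` carrier M) (I 0) \<and>
     (\<forall>i. essential_submodule A (d i ` carrier (I i)) (I (Suc i)))"

definition first_nonprojective ::
  "('a, 'r) ring_scheme \<Rightarrow> (nat \<Rightarrow> 'a umodule) \<Rightarrow> enat" where
  "first_nonprojective A I =
     (if \<forall>i. projective_module A (I i) then \<infinity>
      else enat (LEAST i. \<not> projective_module A (I i)))"

text \<open>A minimal injective coresolution is unique up to isomorphism, so the set below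
  is a singleton for finitely generated \<open>M\<close> and \<open>Sup\<close> merely selects its element.\<close>

definition dominant_dimension ::
  "('a, 'r) ring_scheme \<Rightarrow> ('a, 'm) module \<Rightarrow> enat" where
  "dominant_dimension A M =
     Sup {first_nonprojective A I | I d e. minimal_injective_coresolution A M I d e}"

definition higher_auslander_algebra :: "'a set \<Rightarrow> ('a, 'r) ring_scheme \<Rightarrow> bool" where
  "higher_auslander_algebra K A \<longleftrightarrow> finite_dimensional_algebra K A \<and>
     (\<exists>n::nat. n \<ge> 2 \<and> global_dimension A \<le> enat n \<and>
        enat n \<le> dominant_dimension A (regular_module A))"


section \<open>Torsion modules\<close>

definition opposite_ring :: "('a, 'r) ring_scheme \<Rightarrow> ('a, 'r) ring_scheme" where
  "opposite_ring A = A\<lparr>mult := \<lambda>a b. b \<otimes>\<^bsub>A\<^esub> a\<rparr>"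

text \<open>\<open>Hom\<^sub>A(M, A)\<close> for a left \<open>A\<close>-module \<open>M\<close> is a right \<open>A\<close>-module by
  \<open>(f a)(m) = f(m) a\<close>. Right modules are represented as left modules over
  \<^const>\<open>opposite_ring\<close>. Functions are normalised outside the carrier of \<open>M\<close>
  so that equality of homomorphisms is equality in HOL.\<close>

definition dual_module :: "('a, 'r) ring_scheme \<Rightarrow> ('a, 'm) module \<Rightarrow> ('a, 'm \<Rightarrow> 'a) module" where
  "dual_module A M =
     \<lparr>carrier = left_module_hom A M (regular_module A) \<inter> extensional (carrier M),
      mult = undefined, one = undefined,
      zero = (\<lambda>m\<in>carrier M. \<zero>\<^bsub>A\<^esub>),
      add = (\<lambda>f g. \<lambda>m\<in>carrier M. f m \<oplus>\<^bsub>A\<^esub> g m),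
      smult = (\<lambda>a f. \<lambda>m\<in>carrier M. f m \<otimes>\<^bsub>A\<^esub> a)\<rparr>"

text \<open>The dual of a right module is a left module over the opposite of the opposite ring,
  which is \<open>A\<close> itself.\<close>

definition double_dual ::
  "('a, 'r) ring_scheme \<Rightarrow> ('a, 'm) module \<Rightarrow> ('a, ('m \<Rightarrow> 'a) \<Rightarrow> 'a) module" where
  "double_dual A M = dual_module (opposite_ring A) (dual_module A M)"

definition evaluation_map ::
  "('a, 'r) ring_scheme \<Rightarrow> ('a, 'm) module \<Rightarrow> 'm \<Rightarrow> (('m \<Rightarrow> 'a) \<Rightarrow> 'a)" where
  "evaluation_map A M m = (\<lambda>f\<in>carrier (dual_module A M). f m)"

definition torsion_submodule ::
  "('a, 'r) ring_scheme \<Rightarrow> ('a, 'm) module \<Rightarrow> ('a, 'm) module" where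
  "torsion_submodule A M =
     M\<lparr>carrier := a_kernel M (double_dual A M) (evaluation_map A M)\<rparr>"

definition torsion_module :: "('a, 'r) ring_scheme \<Rightarrow> ('a, 'm) module \<Rightarrow> bool" where
  "torsion_module A T \<longleftrightarrow> left_module A T \<and>
     (\<exists>M :: 'a umodule. fg_left_module A M \<and>
        left_module_isomorphic A T (torsion_submodule A M))"

end

theory Submission
  imports Defs
begin

text \<open>Let \<open>n \<ge> 2\<close> satisfy \<open>gldim A \<le> n \<le> domdim A\<close>, and let \<open>0 \<rightarrow> A \<rightarrow> I 0 \<rightarrow> I 1 \<rightarrow> \<dots>\<close> be an injective
  coresolution in which \<open>I 0, \<dots>, I (n-1)\<close> are projective. The torsion module is, up to isomorphism, the
  submodule \<open>U\<close> of a finitely generated module \<open>M\<close> on which all functionals \<open>M \<rightarrow> A\<close> vanish.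

  The torsion module has no non-zero maps to projectives: a functional on \<open>U\<close>, viewed as a map into \<open>I 0\<close>,
  extends to \<open>M\<close> by injectivity of \<open>I 0\<close>, and as \<open>I 0\<close> is also projective, hence a summand of a free module,
  the extension kills \<open>U\<close> (\<open>hom_from_torsion_to_projective_zero\<close>). In particular \<open>Hom(U, I j) = 0\<close> for
  \<open>j < n\<close>, and dimension shifting along the coresolution gives \<open>Ext\<^sup>i(U, A) = 0\<close> for \<open>i < n\<close>. This is carried
  out on cocycles, without derived functors, in \<open>cocycle_lifting\<close>.

  A finitely generated projective resolution of \<open>U\<close> of length \<open>p < n\<close> would thus become exact when mapped
  to any finitely generated projective module, so it would be contractible and \<open>U = 0\<close>
  (\<open>resolved_module_zero\<close>). Hence a non-zero \<open>U\<close> has projective dimension at least \<open>n \<ge> gldim A\<close>.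

  Conversely, \<open>U\<close> is finitely generated because \<open>A\<close> is finite-dimensional and therefore left noetherian
  (\<open>submodule_of_fg_is_fg\<close>), so its projective dimension is at most \<open>gldim A\<close>.\<close>

section \<open>Homomorphisms and submodules\<close>

lemma left_module_homI:
  assumes "\<And>x. x \<in> carrier M \<Longrightarrow> f x \<in> carrier N"
    and "\<And>x y. \<lbrakk>x \<in> carrier M; y \<in> carrier M\<rbrakk> \<Longrightarrow> f (x \<oplus>\<^bsub>M\<^esub> y) = f x \<oplus>\<^bsub>N\<^esub> f y"
    and "\<And>a x. \<lbrakk>a \<in> carrier A; x \<in> carrier M\<rbrakk> \<Longrightarrow> f (a \<odot>\<^bsub>M\<^esub> x) = a \<odot>\<^bsub>N\<^esub> f x"
  shows "f \<in> left_module_hom A M N"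
  using assms unfolding left_module_hom_def by auto

lemma left_module_homD:
  assumes "f \<in> left_module_hom A M N"
  shows hom_closed: "x \<in> carrier M \<Longrightarrow> f x \<in> carrier N"
    and hom_add: "\<lbrakk>x \<in> carrier M; y \<in> carrier M\<rbrakk> \<Longrightarrow> f (x \<oplus>\<^bsub>M\<^esub> y) = f x \<oplus>\<^bsub>N\<^esub> f y"
    and hom_smult: "\<lbrakk>a \<in> carrier A; x \<in> carrier M\<rbrakk> \<Longrightarrow> f (a \<odot>\<^bsub>M\<^esub> x) = a \<odot>\<^bsub>N\<^esub> f x"
  using assms unfolding left_module_hom_def by auto

lemma (in left_module) zero_smult:
  assumes "x \<in> carrier M"
  shows "\<zero> \<odot>\<^bsub>M\<^esub> x = \<zero>\<^bsub>M\<^esub>"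
  using smult_l_distr[of \<zero> \<zero> x] smult_closed[of \<zero> x] assms
  by (metis M.add.l_cancel_one R.l_zero R.zero_closed)

lemma (in left_module) smult_zero:
  assumes "a \<in> carrier R"
  shows "a \<odot>\<^bsub>M\<^esub> \<zero>\<^bsub>M\<^esub> = \<zero>\<^bsub>M\<^esub>"
  using smult_r_distr[of a "\<zero>\<^bsub>M\<^esub>" "\<zero>\<^bsub>M\<^esub>"] smult_closed[of a "\<zero>\<^bsub>M\<^esub>"] assms
  by (metis M.add.l_cancel_one M.l_zero M.zero_closed)

lemma hom_zero:
  assumes "left_module A M" "left_module A N" "f \<in> left_module_hom A M N"
  shows "f \<zero>\<^bsub>M\<^esub> = \<zero>\<^bsub>N\<^esub>"
proof -
  interpret M: left_module A M by fact
  interpret N: left_module A N by fact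
  have "f \<zero>\<^bsub>M\<^esub> \<oplus>\<^bsub>N\<^esub> f \<zero>\<^bsub>M\<^esub> = f \<zero>\<^bsub>M\<^esub>"
    using hom_add[OF assms(3), of "\<zero>\<^bsub>M\<^esub>" "\<zero>\<^bsub>M\<^esub>"] by simp
  then show ?thesis
    using hom_closed[OF assms(3)] by (metis M.M.zero_closed N.M.add.l_cancel_one)
qed

lemma hom_uminus:
  assumes "left_module A M" "left_module A N" "f \<in> left_module_hom A M N" "x \<in> carrier M"
  shows "f (\<ominus>\<^bsub>M\<^esub> x) = \<ominus>\<^bsub>N\<^esub> f x"
proof -
  interpret M: left_module A M by fact
  interpret N: left_module A N by fact
  have "f (\<ominus>\<^bsub>M\<^esub> x) \<oplus>\<^bsub>N\<^esub> f x = \<zero>\<^bsub>N\<^esub>"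
    using hom_add[OF assms(3), of "\<ominus>\<^bsub>M\<^esub> x" x] assms(4) hom_zero[OF assms(1-3)]
    by (simp add: M.M.l_neg)
  then show ?thesis
    using hom_closed[OF assms(3)] assms(4) by (metis M.M.a_inv_closed N.M.minus_equality)
qed

lemma hom_diff:
  assumes "left_module A M" "left_module A N" "f \<in> left_module_hom A M N"
    "x \<in> carrier M" "y \<in> carrier M"
  shows "f (x \<ominus>\<^bsub>M\<^esub> y) = f x \<ominus>\<^bsub>N\<^esub> f y"
proof -
  interpret M: left_module A M by fact
  show ?thesis
    using assms by (simp add: a_minus_def hom_add[OF assms(3)] hom_uminus[OF assms(1-3)])
qed

lemma hom_comp:
  assumes "f \<in> left_module_hom A L M" "g \<in> left_module_hom A M N"
  shows "(\<lambda>x. g (f x)) \<in> left_module_hom A L N"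
  using assms by (auto intro!: left_module_homI simp: left_module_homD)

lemma hom_ident: "(\<lambda>x. x) \<in> left_module_hom A M M"
  by (auto intro!: left_module_homI)

lemma hom_zero_map:
  assumes "left_module A N"
  shows "(\<lambda>x. \<zero>\<^bsub>N\<^esub>) \<in> left_module_hom A M N"
proof -
  interpret N: left_module A N by fact
  show ?thesis by (auto intro!: left_module_homI simp: N.smult_zero)
qed

lemma smult_uminus:
  fixes N :: "('a, 'n) module"
  assumes "left_module A N" "a \<in> carrier A" "x \<in> carrier N"
  shows "a \<odot>\<^bsub>N\<^esub> (\<ominus>\<^bsub>N\<^esub> x) = \<ominus>\<^bsub>N\<^esub> (a \<odot>\<^bsub>N\<^esub> x)"
proof -
  interpret N: left_module A N by fact
  have "a \<odot>\<^bsub>N\<^esub> (\<ominus>\<^bsub>N\<^esub> x) \<oplus>\<^bsub>N\<^esub> a \<odot>\<^bsub>N\<^esub> x = a \<odot>\<^bsub>N\<^esub> \<zero>\<^bsub>N\<^esub>"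
    using assms by (simp add: N.smult_r_distr[symmetric] N.M.l_neg)
  also have "\<dots> = \<zero>\<^bsub>N\<^esub>" using assms(2) by (rule N.smult_zero)
  finally show ?thesis
    using assms N.smult_closed by (metis N.M.a_inv_closed N.M.minus_equality)
qed

lemma hom_diff_map:
  assumes "left_module A M" "left_module A N"
    and f: "f \<in> left_module_hom A M N" and g: "g \<in> left_module_hom A M N"
  shows "(\<lambda>x. f x \<ominus>\<^bsub>N\<^esub> g x) \<in> left_module_hom A M N"
proof -
  interpret M: left_module A M by fact
  interpret N: left_module A N by fact
  note c = hom_closed[OF f] hom_closed[OF g]
  show ?thesis
    by (intro left_module_homI)
      (simp_all add: c hom_add[OF f] hom_add[OF g] hom_smult[OF f] hom_smult[OF g] N.smult_closed
        a_minus_def N.M.minus_add N.M.a_ac N.smult_r_distr smult_uminus[OF assms(2)])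
qed

lemma submodule_iff:
  fixes M :: "('a, 'm) module"
  assumes "left_module A M"
  shows "submodule H A M \<longleftrightarrow> H \<subseteq> carrier M \<and> \<zero>\<^bsub>M\<^esub> \<in> H \<and>
    (\<forall>x\<in>H. \<forall>y\<in>H. x \<oplus>\<^bsub>M\<^esub> y \<in> H) \<and> (\<forall>a\<in>carrier A. \<forall>x\<in>H. a \<odot>\<^bsub>M\<^esub> x \<in> H)"
    (is "_ \<longleftrightarrow> ?R")
proof
  interpret M: left_module A M by fact
  show ?R if "submodule H A M"
  proof -
    interpret H: submodule H A M by fact
    show ?R using H.subset H.one_closed H.m_closed H.smult_closed by auto
  qed
  show "submodule H A M" if R: ?R
  proof -
    have "\<ominus>\<^bsub>M\<^esub> x = (\<ominus>\<^bsub>A\<^esub> \<one>\<^bsub>A\<^esub>) \<odot>\<^bsub>M\<^esub> x" if x: "x \<in> carrier M" for x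
    proof -
      have "\<zero>\<^bsub>A\<^esub> \<odot>\<^bsub>M\<^esub> x = \<zero>\<^bsub>M\<^esub>" using x by (rule M.zero_smult)
      then have "(\<ominus>\<^bsub>A\<^esub> \<one>\<^bsub>A\<^esub>) \<odot>\<^bsub>M\<^esub> x \<oplus>\<^bsub>M\<^esub> x = \<zero>\<^bsub>M\<^esub>"
        using M.smult_l_distr[of "\<ominus>\<^bsub>A\<^esub> \<one>\<^bsub>A\<^esub>" "\<one>\<^bsub>A\<^esub>" x] x M.smult_one M.R.l_neg[of "\<one>\<^bsub>A\<^esub>"] by simp
      then show ?thesis
        using x by (metis M.M.minus_equality M.R.a_inv_closed M.R.one_closed M.smult_closed)
    qed
    then have "\<ominus>\<^bsub>M\<^esub> x \<in> H" if "x \<in> H" for x using R that by auto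
    then show ?thesis
      using R by (intro submodule.intro subgroup.intro submodule_axioms.intro) (auto simp: a_inv_def)
  qed
qed

lemma submodule_uminus:
  assumes "submodule H A M" "x \<in> H"
  shows "\<ominus>\<^bsub>M\<^esub> x \<in> H"
  using subgroup.m_inv_closed[OF submodule.axioms(1)[OF assms(1)] assms(2)]
  by (simp add: a_inv_def)

lemma submodule_is_left_module:
  fixes M :: "('a, 'm) module"
  assumes "left_module A M" "submodule H A M"
  shows "left_module A (M\<lparr>carrier := H\<rparr>)"
proof -
  interpret M: left_module A M by fact
  interpret H: submodule H A M by fact
  have "abelian_group (M\<lparr>carrier := H\<rparr>)"
  proof (rule abelian_groupI)
    fix x assume "x \<in> carrier (M\<lparr>carrier := H\<rparr>)"
    then show "\<exists>y\<in>carrier (M\<lparr>carrier := H\<rparr>). y \<oplus>\<^bsub>M\<lparr>carrier := H\<rparr>\<^esub> x = \<zero>\<^bsub>M\<lparr>carrier := H\<rparr>\<^esub>"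
      using submodule_uminus[OF assms(2)] M.M.l_neg[of x] H.subset
      by (intro bexI[of _ "\<ominus>\<^bsub>M\<^esub> x"]) auto
  qed (use H.subset H.m_closed H.one_closed in \<open>auto simp: subset_iff M.M.a_ac\<close>)
  then show ?thesis
    using H.subset H.smult_closed unfolding left_module_def left_module_axioms_def
    by (auto simp: M.R.ring_axioms subset_iff M.smult_l_distr M.smult_r_distr M.smult_assoc1 M.smult_one)
qed

lemma image_submodule:
  assumes "left_module A M" "left_module A N" "f \<in> left_module_hom A M N"
  shows "submodule (f ` carrier M) A N"
proof -
  interpret M: left_module A M by fact
  show ?thesis
    unfolding submodule_iff[OF assms(2)]
    using hom_closed[OF assms(3)] M.smult_closed
    by (auto simp flip: hom_zero[OF assms] hom_add[OF assms(3)] hom_smult[OF assms(3)])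
qed

lemma submodule_Int:
  fixes M :: "('a, 'm) module"
  assumes "left_module A M" "submodule H A M" "submodule L A M"
  shows "submodule (H \<inter> L) A M"
  using assms(2,3) unfolding submodule_iff[OF assms(1)] by auto

text \<open>The homomorphism theorem. Working with the image of \<open>g\<close>, a submodule of \<open>N\<close>, rather than
  with \<open>P\<close> modulo the kernel of \<open>g\<close> keeps the carrier in a type for which projectivity and
  injectivity provide lifts and extensions.\<close>

lemma hom_factor_through_image:
  assumes P: "left_module A P" and N: "left_module A N" and Q: "left_module A Q"
    and g: "g \<in> left_module_hom A P N" and f: "f \<in> left_module_hom A P Q"
    and ker: "\<And>x. \<lbrakk>x \<in> carrier P; g x = \<zero>\<^bsub>N\<^esub>\<rbrakk> \<Longrightarrow> f x = \<zero>\<^bsub>Q\<^esub>"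
  obtains f' where "f' \<in> left_module_hom A (N\<lparr>carrier := g ` carrier P\<rparr>) Q"
    "\<And>x. x \<in> carrier P \<Longrightarrow> f' (g x) = f x"
proof -
  interpret P: left_module A P by fact
  interpret N: left_module A N by fact
  interpret Q: left_module A Q by fact
  have fib: "f x = f y" if x: "x \<in> carrier P" and y: "y \<in> carrier P" and e: "g x = g y" for x y
  proof -
    have "g (x \<ominus>\<^bsub>P\<^esub> y) = \<zero>\<^bsub>N\<^esub>"
      using hom_diff[OF P N g x y] e hom_closed[OF g y] by (simp add: a_minus_def N.M.r_neg)
    then have "f x \<ominus>\<^bsub>Q\<^esub> f y = \<zero>\<^bsub>Q\<^esub>"
      using ker[of "x \<ominus>\<^bsub>P\<^esub> y"] x y hom_diff[OF P Q f x y] by simp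
    then show ?thesis
      using hom_closed[OF f] x y by (metis Q.M.a_inv_closed Q.M.minus_equality Q.M.minus_minus a_minus_def)
  qed
  define f' where "f' = (\<lambda>z. f (SOME x. x \<in> carrier P \<and> g x = z))"
  have f': "f' (g x) = f x" if "x \<in> carrier P" for x
  proof -
    have "(SOME y. y \<in> carrier P \<and> g y = g x) \<in> carrier P \<and> g (SOME y. y \<in> carrier P \<and> g y = g x) = g x"
      by (rule someI[of _ x]) (simp add: that)
    then show ?thesis unfolding f'_def using fib that by blast
  qed
  have "f' \<in> left_module_hom A (N\<lparr>carrier := g ` carrier P\<rparr>) Q"
  proof (rule left_module_homI, goal_cases)
    case (1 x) then show ?case using f' hom_closed[OF f] by auto
  next
    case (2 x y)
    then obtain u v where "u \<in> carrier P" "v \<in> carrier P" "x = g u" "y = g v" by auto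
    then show ?case
      using f' f'[of "u \<oplus>\<^bsub>P\<^esub> v"] by (simp add: hom_add[OF f] hom_add[OF g])
  next
    case (3 a x)
    then obtain u where "u \<in> carrier P" "x = g u" by auto
    then show ?case
      using f' f'[of "a \<odot>\<^bsub>P\<^esub> u"] 3 by (simp add: hom_smult[OF f] hom_smult[OF g] P.smult_closed)
  qed
  with f' that show ?thesis by blast
qed

lemma injective_moduleD:
  fixes V W :: "'a umodule"
  assumes "injective_module A I" "left_module A V" "left_module A W"
    "g \<in> left_module_hom A V W" "inj_on g (carrier V)" "f \<in> left_module_hom A V I"
  shows "\<exists>h\<in>left_module_hom A W I. \<forall>x\<in>carrier V. h (g x) = f x"
  using assms(1)[unfolded injective_module_def, THEN conjunct2, rule_format, of V W g f] assms(2-)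
  by blast

lemma projective_moduleD:
  fixes V W :: "'a umodule"
  assumes "projective_module A P" "left_module A V" "left_module A W"
    "g \<in> left_module_hom A V W" "g ` carrier V = carrier W" "f \<in> left_module_hom A P W"
  shows "\<exists>h\<in>left_module_hom A P V. \<forall>p\<in>carrier P. g (h p) = f p"
  using assms(1)[unfolded projective_module_def, THEN conjunct2, rule_format, of V W g f] assms(2-)
  by blast

text \<open>The defining extension property concerns an injective map. A map \<open>f\<close> that vanishes on the
  kernel of an arbitrary \<open>g\<close> factors through the image of \<open>g\<close>, and the factor extends along the
  inclusion of that image. Dually, a lift along a map that is not onto exists as soon as its
  image is large enough. Maps between the terms of exact sequences are produced in these forms.\<close>

lemma injective_extension:
  fixes P N Q :: "'a umodule"
  assumes P: "left_module A P" and N: "left_module A N" and Q: "injective_module A Q"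
    and g: "g \<in> left_module_hom A P N" and f: "f \<in> left_module_hom A P Q"
    and ker: "\<And>x. \<lbrakk>x \<in> carrier P; g x = \<zero>\<^bsub>N\<^esub>\<rbrakk> \<Longrightarrow> f x = \<zero>\<^bsub>Q\<^esub>"
  shows "\<exists>h\<in>left_module_hom A N Q. \<forall>x\<in>carrier P. h (g x) = f x"
proof -
  let ?V = "N\<lparr>carrier := g ` carrier P\<rparr>"
  have Q': "left_module A Q" using Q unfolding injective_module_def by blast
  obtain f' where f': "f' \<in> left_module_hom A ?V Q" "\<And>x. x \<in> carrier P \<Longrightarrow> f' (g x) = f x"
    using hom_factor_through_image[OF P N Q' g f ker] by blast
  have V: "left_module A ?V"
    by (rule submodule_is_left_module[OF N image_submodule[OF P N g]])
  have incl: "(\<lambda>x. x) \<in> left_module_hom A ?V N"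
    using hom_closed[OF g] by (auto intro!: left_module_homI)
  have "\<exists>h\<in>left_module_hom A N Q. \<forall>x\<in>carrier ?V. h x = f' x"
    using injective_moduleD[OF Q V N incl _ f'(1)] by (simp add: inj_on_def)
  then show ?thesis using f'(2) by auto
qed

lemma projective_lift:
  fixes P V W :: "'a umodule"
  assumes P: "projective_module A P" and V: "left_module A V" and W: "left_module A W"
    and g: "g \<in> left_module_hom A V W" and f: "f \<in> left_module_hom A P W"
    and im: "\<And>x. x \<in> carrier P \<Longrightarrow> f x \<in> g ` carrier V"
  shows "\<exists>h\<in>left_module_hom A P V. \<forall>x\<in>carrier P. g (h x) = f x"
proof -
  let ?W = "W\<lparr>carrier := g ` carrier V\<rparr>"
  have W': "left_module A ?W"
    by (rule submodule_is_left_module[OF W image_submodule[OF V W g]])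
  have g': "g \<in> left_module_hom A V ?W"
    using g by (auto intro!: left_module_homI simp: left_module_homD)
  have f': "f \<in> left_module_hom A P ?W"
    using f im by (auto intro!: left_module_homI simp: left_module_homD)
  show ?thesis
    by (rule projective_moduleD[OF P V W' g' _ f']) simp
qed

section \<open>Finitely generated projective modules are retracts of free modules\<close>

text \<open>Vectors are padded with zeros beyond the rank, so that the free modules of all finite ranks
  live in the type over which projectivity is tested.\<close>

definition free_module :: "('a, 'r) ring_scheme \<Rightarrow> nat \<Rightarrow> 'a umodule" where
  "free_module A k =
     \<lparr>carrier = {v. (\<forall>i<k. v i \<in> carrier A) \<and> (\<forall>i\<ge>k. v i = \<zero>\<^bsub>A\<^esub>)},
      mult = undefined, one = undefined,
      zero = (\<lambda>i. \<zero>\<^bsub>A\<^esub>), add = (\<lambda>v w i. v i \<oplus>\<^bsub>A\<^esub> w i), smult = (\<lambda>a v i. a \<otimes>\<^bsub>A\<^esub> v i)\<rparr>"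

lemma free_module_simps:
  "carrier (free_module A k) = {v. (\<forall>i<k. v i \<in> carrier A) \<and> (\<forall>i\<ge>k. v i = \<zero>\<^bsub>A\<^esub>)}"
  "\<zero>\<^bsub>free_module A k\<^esub> = (\<lambda>i. \<zero>\<^bsub>A\<^esub>)"
  "v \<oplus>\<^bsub>free_module A k\<^esub> w = (\<lambda>i. v i \<oplus>\<^bsub>A\<^esub> w i)"
  "a \<odot>\<^bsub>free_module A k\<^esub> v = (\<lambda>i. a \<otimes>\<^bsub>A\<^esub> v i)"
  by (simp_all add: free_module_def)

lemma regular_module_simps:
  "carrier (regular_module A) = carrier A"
  "\<zero>\<^bsub>regular_module A\<^esub> = \<zero>\<^bsub>A\<^esub>"
  "x \<oplus>\<^bsub>regular_module A\<^esub> y = x \<oplus>\<^bsub>A\<^esub> y"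
  "a \<odot>\<^bsub>regular_module A\<^esub> x = a \<otimes>\<^bsub>A\<^esub> x"
  by (simp_all add: regular_module_def)

lemma regular_module_left_module:
  assumes "ring A"
  shows "left_module A (regular_module A)"
proof -
  interpret A: ring A by fact
  have "abelian_group (regular_module A)"
  proof (rule abelian_groupI)
    fix x assume "x \<in> carrier (regular_module A)"
    then show "\<exists>y\<in>carrier (regular_module A). y \<oplus>\<^bsub>regular_module A\<^esub> x = \<zero>\<^bsub>regular_module A\<^esub>"
      by (auto intro!: bexI[of _ "\<ominus>\<^bsub>A\<^esub> x"] simp: regular_module_simps A.l_neg)
  qed (simp_all add: regular_module_simps A.a_ac)
  then show ?thesis
    unfolding left_module_def left_module_axioms_def
    by (simp add: assms regular_module_simps A.l_distr A.r_distr A.m_assoc)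
qed

lemma free_module_left_module:
  assumes "ring A"
  shows "left_module A (free_module A k)"
proof -
  interpret A: ring A by fact
  have cl: "v i \<in> carrier A" if "v \<in> carrier (free_module A k)" for v i
    using that by (cases "i < k") (auto simp: free_module_simps)
  have "abelian_group (free_module A k)"
  proof (rule abelian_groupI)
    fix v assume v: "v \<in> carrier (free_module A k)"
    then show "\<exists>y\<in>carrier (free_module A k). y \<oplus>\<^bsub>free_module A k\<^esub> v = \<zero>\<^bsub>free_module A k\<^esub>"
      using cl[OF v]
      by (intro bexI[of _ "\<lambda>i. \<ominus>\<^bsub>A\<^esub> v i"]) (auto simp: free_module_simps A.l_neg)
  next
    fix u v w assume "u \<in> carrier (free_module A k)" "v \<in> carrier (free_module A k)"
      "w \<in> carrier (free_module A k)"
    then show "(u \<oplus>\<^bsub>free_module A k\<^esub> v) \<oplus>\<^bsub>free_module A k\<^esub> w =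
        u \<oplus>\<^bsub>free_module A k\<^esub> (v \<oplus>\<^bsub>free_module A k\<^esub> w)"
      using cl by (simp add: free_module_simps(3) A.a_assoc)
  next
    fix u v assume "u \<in> carrier (free_module A k)" "v \<in> carrier (free_module A k)"
    then show "u \<oplus>\<^bsub>free_module A k\<^esub> v = v \<oplus>\<^bsub>free_module A k\<^esub> u"
      using cl by (simp add: free_module_simps(3) A.a_comm)
  next
    fix u assume "u \<in> carrier (free_module A k)"
    then show "\<zero>\<^bsub>free_module A k\<^esub> \<oplus>\<^bsub>free_module A k\<^esub> u = u"
      using cl by (simp add: free_module_simps(2,3))
  qed (auto simp: free_module_simps)
  moreover have "left_module_axioms A (free_module A k)"
  proof (unfold_locales, goal_cases)
    case (1 a v) then show ?case by (auto simp: free_module_simps)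
  next
    case (2 a b v) then show ?case using cl by (simp add: free_module_simps(3,4) A.l_distr)
  next
    case (3 a v w) then show ?case using cl by (simp add: free_module_simps(3,4) A.r_distr)
  next
    case (4 a b v) then show ?case using cl by (simp add: free_module_simps(4) A.m_assoc)
  next
    case (5 v) then show ?case using cl by (simp add: free_module_simps(4))
  qed
  ultimately show ?thesis unfolding left_module_def using assms by blast
qed

lemma hom_into_free_module:
  assumes "left_module A Y" and "\<And>i. i < k \<Longrightarrow> \<phi> i \<in> left_module_hom A Y (regular_module A)"
  shows "(\<lambda>y i. if i < k then \<phi> i y else \<zero>\<^bsub>A\<^esub>) \<in> left_module_hom A Y (free_module A k)"
proof -
  interpret Y: left_module A Y by fact
  show ?thesis
    using left_module_homD[OF assms(2), unfolded regular_module_simps]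
    by (intro left_module_homI) (auto simp: free_module_simps fun_eq_iff)
qed

lemma free_module_coordinate_hom:
  assumes "ring A"
  shows "(\<lambda>v. v i) \<in> left_module_hom A (free_module A k) (regular_module A)"
proof -
  interpret A: ring A by fact
  show ?thesis
    by (cases "i < k") (auto intro!: left_module_homI simp: free_module_simps regular_module_simps)
qed

text \<open>Induction on the rank avoids linear combinations: the last coordinate contributes its multiple of
  the last target vector, and truncation reduces to smaller rank.\<close>

lemma hom_from_free_module:
  assumes M: "left_module A M" and x: "\<And>i. i < k \<Longrightarrow> x i \<in> carrier M"
  obtains r where "r \<in> left_module_hom A (free_module A k) M" "x ` {..<k} \<subseteq> r ` carrier (free_module A k)"
  using x
proof (induction k arbitrary: thesis)
  case 0
  show ?case by (rule 0(1)[OF hom_zero_map[OF M]]) simp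
next
  case (Suc k)
  interpret M: left_module A M by fact
  obtain r where r: "r \<in> left_module_hom A (free_module A k) M"
    "x ` {..<k} \<subseteq> r ` carrier (free_module A k)"
    using Suc.IH Suc.prems(2) by (metis less_SucI)
  let ?F = "free_module A (Suc k)"
  let ?t = "\<lambda>v i. if i < k then v i else \<zero>\<^bsub>A\<^esub>"
  have t: "?t \<in> left_module_hom A ?F (free_module A k)"
    by (rule hom_into_free_module[OF free_module_left_module[OF M.R.ring_axioms]
          free_module_coordinate_hom[OF M.R.ring_axioms]])
  have xk: "x k \<in> carrier M" using Suc.prems(2) by simp
  have s: "(\<lambda>v. v k \<odot>\<^bsub>M\<^esub> x k) \<in> left_module_hom A ?F M"
    using xk
    by (auto intro!: left_module_homI simp: free_module_simps M.smult_closed M.smult_l_distr M.smult_assoc1)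
  define r' where "r' = (\<lambda>v. r (?t v) \<oplus>\<^bsub>M\<^esub> v k \<odot>\<^bsub>M\<^esub> x k)"
  note rt = hom_comp[OF t r(1)]
  have r': "r' \<in> left_module_hom A ?F M"
    unfolding r'_def
    by (intro left_module_homI)
      (simp_all add: hom_closed[OF rt] hom_closed[OF s] hom_add[OF rt] hom_add[OF s] hom_smult[OF rt]
        hom_smult[OF s] M.smult_r_distr M.smult_closed M.M.a_ac)
  have "x i \<in> r' ` carrier ?F" if i: "i < Suc k" for i
  proof (cases "i = k")
    case True
    let ?v = "\<lambda>i. if i = k then \<one>\<^bsub>A\<^esub> else \<zero>\<^bsub>A\<^esub>"
    have "r \<zero>\<^bsub>free_module A k\<^esub> = \<zero>\<^bsub>M\<^esub>"
      by (rule hom_zero[OF free_module_left_module[OF M.R.ring_axioms] M r(1)])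
    moreover have "?t ?v = \<zero>\<^bsub>free_module A k\<^esub>" by (auto simp: free_module_simps)
    ultimately have "r' ?v = x k" using xk by (simp add: r'_def M.smult_one)
    moreover have "?v \<in> carrier ?F" by (auto simp: free_module_simps)
    ultimately show ?thesis using True by (metis imageI)
  next
    case False
    then have "x i \<in> r ` carrier (free_module A k)" using r(2) i by auto
    then obtain v where v: "v \<in> carrier (free_module A k)" "x i = r v" by auto
    then have "?t v = v" "v k = \<zero>\<^bsub>A\<^esub>" "v \<in> carrier ?F"
      by (auto simp: free_module_simps fun_eq_iff) (metis M.R.zero_closed le_less_Suc_eq not_less_eq linorder_not_less)
    moreover have "\<zero>\<^bsub>A\<^esub> \<odot>\<^bsub>M\<^esub> x k = \<zero>\<^bsub>M\<^esub>"
      using xk by (rule M.zero_smult)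
    ultimately have "r' v = x i" using v hom_closed[OF r(1)] by (simp add: r'_def)
    then show ?thesis using \<open>v \<in> carrier ?F\<close> by (metis imageI)
  qed
  then show ?case using r' by (intro Suc.prems(1)) auto
qed

lemma fg_projective_retract_of_free:
  assumes "fg_left_module A P" and "projective_module A P"
  shows "\<exists>k. \<exists>r\<in>left_module_hom A (free_module A k) P. \<exists>s\<in>left_module_hom A P (free_module A k).
    \<forall>x\<in>carrier P. r (s x) = x"
proof -
  have P: "left_module A P" using assms(1) unfolding fg_left_module_def by blast
  interpret P: left_module A P by fact
  obtain S where S: "finite S" "S \<subseteq> carrier P"
    "\<And>H. \<lbrakk>submodule H A P; S \<subseteq> H\<rbrakk> \<Longrightarrow> H = carrier P"
    using assms(1) unfolding fg_left_module_def by blast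
  obtain x and k :: nat where x: "S = x ` {..<k}"
    using finite_imp_nat_seg_image_inj_on[OF S(1)] by (auto simp: lessThan_def)
  then have "\<And>i. i < k \<Longrightarrow> x i \<in> carrier P" using S(2) by auto
  then obtain r where r: "r \<in> left_module_hom A (free_module A k) P"
    "x ` {..<k} \<subseteq> r ` carrier (free_module A k)"
    using hom_from_free_module[OF P] by blast
  note F = free_module_left_module[OF P.R.ring_axioms, of k]
  have "r ` carrier (free_module A k) = carrier P"
    using S(3)[OF image_submodule[OF F P r(1)]] r(2) x by simp
  then obtain s where "s \<in> left_module_hom A P (free_module A k)" "\<And>y. y \<in> carrier P \<Longrightarrow> r (s y) = y"
    using projective_moduleD[OF assms(2) F P r(1) _ hom_ident] by blast
  with r(1) show ?thesis by blast
qed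

text \<open>The coordinates of \<open>F x\<close> in a free module containing \<open>Q\<close> are values of functionals on \<open>M\<close> at
  \<open>x\<close>. So the reject of \<open>A\<close> in \<open>M\<close> is killed by every map to such a \<open>Q\<close>.\<close>

lemma functionals_detect_projective:
  assumes M: "left_module A M" and Q: "fg_left_module A Q" "projective_module A Q"
    and x: "x \<in> carrier M" and van: "\<And>f. f \<in> left_module_hom A M (regular_module A) \<Longrightarrow> f x = \<zero>\<^bsub>A\<^esub>"
    and F: "F \<in> left_module_hom A M Q"
  shows "F x = \<zero>\<^bsub>Q\<^esub>"
proof -
  interpret M: left_module A M by fact
  have Q': "left_module A Q" using Q(1) unfolding fg_left_module_def by blast
  obtain r k s where rs: "r \<in> left_module_hom A (free_module A k) Q"
    "s \<in> left_module_hom A Q (free_module A k)" "\<And>x. x \<in> carrier Q \<Longrightarrow> r (s x) = x"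
    using fg_projective_retract_of_free[OF Q] by auto
  note A = M.R.ring_axioms
  have "s (F x) i = \<zero>\<^bsub>A\<^esub>" for i
  proof -
    have "(\<lambda>x. s (F x) i) \<in> left_module_hom A M (regular_module A)"
      using hom_comp[OF hom_comp[OF F rs(2)] free_module_coordinate_hom[OF A, of i k]] by simp
    from van[OF this] show ?thesis by simp
  qed
  then have "s (F x) = \<zero>\<^bsub>free_module A k\<^esub>" by (auto simp: free_module_simps)
  then show ?thesis
    using rs(3)[of "F x"] hom_closed[OF F x] hom_zero[OF free_module_left_module[OF A] Q' rs(1)] by simp
qed

text \<open>In the same way, vanishing of cohomology with coefficients in \<open>A\<close> passes to coefficients
  in \<open>Q\<close>: the coordinates of \<open>\<chi>\<close> are extended along \<open>d\<close> one at a time, and the resulting map into the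
  free module is composed with the retraction onto \<open>Q\<close>.\<close>

lemma extension_to_projective:
  assumes X: "left_module A X" and Y: "left_module A Y"
    and Q: "fg_left_module A Q" "projective_module A Q"
    and \<chi>: "\<chi> \<in> left_module_hom A X Q"
    and ext: "\<And>\<phi>. \<phi> \<in> left_module_hom A Q (regular_module A) \<Longrightarrow>
      \<exists>h\<in>left_module_hom A Y (regular_module A). \<forall>x\<in>carrier X. h (d x) = \<phi> (\<chi> x)"
  shows "\<exists>h\<in>left_module_hom A Y Q. \<forall>x\<in>carrier X. h (d x) = \<chi> x"
proof -
  interpret X: left_module A X by fact
  note A = X.R.ring_axioms
  obtain r k s where rs: "r \<in> left_module_hom A (free_module A k) Q"
    "s \<in> left_module_hom A Q (free_module A k)" "\<And>x. x \<in> carrier Q \<Longrightarrow> r (s x) = x"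
    using fg_projective_retract_of_free[OF Q] by auto
  have "\<exists>h\<in>left_module_hom A Y (regular_module A). \<forall>x\<in>carrier X. h (d x) = s (\<chi> x) i" for i
  proof -
    have "(\<lambda>x. s x i) \<in> left_module_hom A Q (regular_module A)"
      using hom_comp[OF rs(2) free_module_coordinate_hom[OF A, of i k]] by simp
    from ext[OF this] show ?thesis by simp
  qed
  then obtain h where h: "\<And>i. h i \<in> left_module_hom A Y (regular_module A)"
    "\<And>i x. x \<in> carrier X \<Longrightarrow> h i (d x) = s (\<chi> x) i"
    by metis
  let ?h = "\<lambda>y i. if i < k then h i y else \<zero>\<^bsub>A\<^esub>"
  have "?h \<in> left_module_hom A Y (free_module A k)"
    using h(1) by (rule hom_into_free_module[OF Y])
  then have "(\<lambda>y. r (?h y)) \<in> left_module_hom A Y Q"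
    using rs(1) by (rule hom_comp)
  moreover have "r (?h (d x)) = \<chi> x" if "x \<in> carrier X" for x
  proof -
    have "?h (d x) = s (\<chi> x)"
      using h(2)[OF that] hom_closed[OF rs(2) hom_closed[OF \<chi> that]]
      by (auto simp: free_module_simps fun_eq_iff)
    then show ?thesis using rs(3) hom_closed[OF \<chi> that] by simp
  qed
  ultimately show ?thesis
    by (intro bexI[of _ "\<lambda>y. r (?h y)"] ballI)
qed

section \<open>Submodules of finitely generated modules\<close>

definition generates :: "('a, 'r) ring_scheme \<Rightarrow> ('a, 'm) module \<Rightarrow> 'm set \<Rightarrow> 'm set \<Rightarrow> bool" where
  "generates A M S H \<longleftrightarrow> S \<subseteq> H \<and> (\<forall>L. submodule L A M \<and> S \<subseteq> L \<longrightarrow> H \<subseteq> L)"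

definition noetherian_below :: "('a, 'r) ring_scheme \<Rightarrow> ('a, 'm) module \<Rightarrow> 'm set \<Rightarrow> bool" where
  "noetherian_below A M N \<longleftrightarrow>
     (\<forall>H. submodule H A M \<and> H \<subseteq> N \<longrightarrow> (\<exists>S. finite S \<and> generates A M S H))"

text \<open>Left ideals are \<open>K\<close>-subspaces of the finite-dimensional space \<open>A\<close>, and a \<open>K\<close>-basis of one
  generates it as a left ideal.\<close>

lemma left_ideal_finitely_generated:
  fixes A (structure)
  assumes "finite_dimensional_algebra K A"
  shows "noetherian_below A (regular_module A) (carrier A)"
proof -
  interpret finite_dimensional_algebra K A by fact
  have KA: "K \<subseteq> carrier A" using subfield by (rule subfieldE(3))
  have subspace: "subalgebra K J A" if "submodule J A (regular_module A)" for J
  proof -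
    have J: "J \<subseteq> carrier A" "\<zero> \<in> J" "\<And>x y. \<lbrakk>x \<in> J; y \<in> J\<rbrakk> \<Longrightarrow> x \<oplus> y \<in> J"
      "\<And>a x. \<lbrakk>a \<in> carrier A; x \<in> J\<rbrakk> \<Longrightarrow> a \<otimes> x \<in> J"
      using that unfolding submodule_iff[OF regular_module_left_module[OF ring_axioms]]
      by (auto simp: regular_module_simps)
    have "\<ominus> x \<in> J" if "x \<in> J" for x
      using J(4)[of "\<ominus> \<one>" x] J(1) that by (auto simp: l_minus)
    then have "subgroup J (add_monoid A)"
      using J by (intro subgroup.intro) (auto simp: a_inv_def)
    then show ?thesis
      using J(4) KA by (auto intro!: subalgebra.intro subalgebra_axioms.intro)
  qed
  show ?thesis
    unfolding noetherian_below_def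
  proof (intro allI impI)
    fix J assume J: "submodule J A (regular_module A) \<and> J \<subseteq> carrier A"
    then have "finite_dimension K J"
      using subalbegra_incl_imp_finite_dimension[OF subfield finite_dimensional subspace] by blast
    then obtain Us where Us: "set Us \<subseteq> carrier A" "Span K Us = J"
      using exists_base[OF subfield finite_dimensionE[OF subfield]] by blast
    have "generates A (regular_module A) (set Us) J"
      unfolding generates_def
      using Span_base_incl[OF subfield Us(1)] subalgebra_Span_incl[OF subfield subspace] Us(2) by auto
    then show "\<exists>S. finite S \<and> generates A (regular_module A) S J" by blast
  qed
qed

text \<open>The step of the Hilbert-style argument. The coefficients of \<open>x\<close> that occur in elements of a submodule
  \<open>L\<close> form a left ideal \<open>J L\<close>. Generators of \<open>H\<close> are obtained from generators of \<open>J H\<close>, lifted to \<open>H\<close>,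
  together with generators of \<open>H \<inter> N\<close>: if \<open>L\<close> contains them all, then \<open>J (L \<inter> H)\<close> contains \<open>J H\<close>, so every
  element of \<open>H\<close> differs from one of \<open>L \<inter> H\<close> by an element of \<open>H \<inter> N\<close>.\<close>

lemma noetherian_below_adjoin:
  fixes M :: "('a, 'm) module" and A (structure)
  assumes M: "left_module A M" and N: "submodule N A M" "noetherian_below A M N"
    and x: "x \<in> carrier M" and A: "noetherian_below A (regular_module A) (carrier A)"
  shows "noetherian_below A M {y \<oplus>\<^bsub>M\<^esub> a \<odot>\<^bsub>M\<^esub> x | y a. y \<in> N \<and> a \<in> carrier A}"
  unfolding noetherian_below_def
proof (intro allI impI)
  interpret M: left_module A M by fact
  have NM: "N \<subseteq> carrier M" using N(1) unfolding submodule_iff[OF M] by blast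
  define J where "J = (\<lambda>L. {a \<in> carrier A. \<exists>y\<in>N. y \<oplus>\<^bsub>M\<^esub> a \<odot>\<^bsub>M\<^esub> x \<in> L})"
  have zx: "\<zero> \<odot>\<^bsub>M\<^esub> x = \<zero>\<^bsub>M\<^esub>" using x by (rule M.zero_smult)
  have J: "submodule (J L) A (regular_module A)" if L: "submodule L A M" for L
  proof -
    note L' = L[unfolded submodule_iff[OF M]] and N' = N(1)[unfolded submodule_iff[OF M]]
    have "\<zero> \<in> J L" using L' N' x by (auto simp: J_def zx intro!: bexI[of _ "\<zero>\<^bsub>M\<^esub>"])
    moreover have "a \<oplus> b \<in> J L" if ab': "a \<in> J L" "b \<in> J L" for a b
    proof -
      have ab: "a \<in> carrier A" "b \<in> carrier A" using ab' by (auto simp: J_def)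
      obtain y where y: "y \<in> N" "y \<oplus>\<^bsub>M\<^esub> a \<odot>\<^bsub>M\<^esub> x \<in> L" using ab'(1) by (auto simp: J_def)
      obtain z where z: "z \<in> N" "z \<oplus>\<^bsub>M\<^esub> b \<odot>\<^bsub>M\<^esub> x \<in> L" using ab'(2) by (auto simp: J_def)
      note yz = y z
      have yzM: "y \<in> carrier M" "z \<in> carrier M" using yz NM by auto
      have "(y \<oplus>\<^bsub>M\<^esub> z) \<oplus>\<^bsub>M\<^esub> (a \<oplus> b) \<odot>\<^bsub>M\<^esub> x = (y \<oplus>\<^bsub>M\<^esub> a \<odot>\<^bsub>M\<^esub> x) \<oplus>\<^bsub>M\<^esub> (z \<oplus>\<^bsub>M\<^esub> b \<odot>\<^bsub>M\<^esub> x)"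
        using yzM ab x by (simp add: M.smult_l_distr M.smult_closed M.M.a_ac)
      then show ?thesis using yz ab L' N' by (auto simp: J_def intro!: bexI[of _ "y \<oplus>\<^bsub>M\<^esub> z"])
    qed
    moreover have "b \<otimes> a \<in> J L" if ba: "b \<in> carrier A" "a \<in> J L" for a b
    proof -
      obtain y where y: "y \<in> N" "y \<oplus>\<^bsub>M\<^esub> a \<odot>\<^bsub>M\<^esub> x \<in> L" and a: "a \<in> carrier A"
        using ba by (auto simp: J_def)
      have "b \<odot>\<^bsub>M\<^esub> y \<oplus>\<^bsub>M\<^esub> (b \<otimes> a) \<odot>\<^bsub>M\<^esub> x = b \<odot>\<^bsub>M\<^esub> (y \<oplus>\<^bsub>M\<^esub> a \<odot>\<^bsub>M\<^esub> x)"
        using y NM a x ba(1) by (auto simp: M.smult_r_distr M.smult_assoc1 M.smult_closed subset_iff)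
      then show ?thesis
        using y a L' N' ba(1) by (auto simp: J_def intro!: bexI[of _ "b \<odot>\<^bsub>M\<^esub> y"])
    qed
    ultimately show ?thesis
      unfolding submodule_iff[OF regular_module_left_module[OF M.R.ring_axioms]]
      by (auto simp: regular_module_simps J_def)
  qed
  fix H assume H: "submodule H A M \<and> H \<subseteq> {y \<oplus>\<^bsub>M\<^esub> a \<odot>\<^bsub>M\<^esub> x | y a. y \<in> N \<and> a \<in> carrier A}"
  then have HM: "H \<subseteq> carrier M" unfolding submodule_iff[OF M] by blast
  obtain S0 where S0: "finite S0" "generates A (regular_module A) S0 (J H)"
    using A J H unfolding noetherian_below_def J_def by blast
  obtain S1 where S1: "finite S1" "generates A M S1 (H \<inter> N)"
    using N(2) submodule_Int[OF M _ N(1)] H unfolding noetherian_below_def by blast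
  have "\<forall>a\<in>S0. \<exists>y\<in>N. y \<oplus>\<^bsub>M\<^esub> a \<odot>\<^bsub>M\<^esub> x \<in> H"
    using S0(2) unfolding generates_def J_def by blast
  then obtain y where y: "\<And>a. a \<in> S0 \<Longrightarrow> y a \<in> N" "\<And>a. a \<in> S0 \<Longrightarrow> y a \<oplus>\<^bsub>M\<^esub> a \<odot>\<^bsub>M\<^esub> x \<in> H"
    by metis
  let ?S = "S1 \<union> (\<lambda>a. y a \<oplus>\<^bsub>M\<^esub> a \<odot>\<^bsub>M\<^esub> x) ` S0"
  have "H \<subseteq> L" if L: "submodule L A M" "?S \<subseteq> L" for L
  proof
    fix h assume h: "h \<in> H"
    obtain z a where za: "z \<in> N" "a \<in> carrier A" "h = z \<oplus>\<^bsub>M\<^esub> a \<odot>\<^bsub>M\<^esub> x" using H h by blast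
    have LH: "submodule (L \<inter> H) A M" using submodule_Int[OF M L(1)] H by blast
    have "S0 \<subseteq> J (L \<inter> H)"
      using S0(2) y L(2) unfolding generates_def J_def by blast
    then have "J H \<subseteq> J (L \<inter> H)"
      using S0(2) J[OF LH] unfolding generates_def by blast
    moreover have "a \<in> J H" using za h by (auto simp: J_def)
    ultimately obtain z' where z': "z' \<in> N" "z' \<oplus>\<^bsub>M\<^esub> a \<odot>\<^bsub>M\<^esub> x \<in> L" "z' \<oplus>\<^bsub>M\<^esub> a \<odot>\<^bsub>M\<^esub> x \<in> H"
      unfolding J_def by blast
    let ?k = "z' \<oplus>\<^bsub>M\<^esub> a \<odot>\<^bsub>M\<^esub> x"
    have c: "z \<in> carrier M" "z' \<in> carrier M" "a \<odot>\<^bsub>M\<^esub> x \<in> carrier M"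
      using za z'(1) NM M.smult_closed x by auto
    have hk: "h \<oplus>\<^bsub>M\<^esub> (\<ominus>\<^bsub>M\<^esub> ?k) = z \<oplus>\<^bsub>M\<^esub> (\<ominus>\<^bsub>M\<^esub> z')"
    proof -
      have "h \<oplus>\<^bsub>M\<^esub> (\<ominus>\<^bsub>M\<^esub> ?k) = z \<oplus>\<^bsub>M\<^esub> (a \<odot>\<^bsub>M\<^esub> x \<oplus>\<^bsub>M\<^esub> (\<ominus>\<^bsub>M\<^esub> (a \<odot>\<^bsub>M\<^esub> x) \<oplus>\<^bsub>M\<^esub> (\<ominus>\<^bsub>M\<^esub> z')))"
        using c by (simp add: za(3) M.M.minus_add M.M.a_ac)
      also have "\<dots> = z \<oplus>\<^bsub>M\<^esub> (\<ominus>\<^bsub>M\<^esub> z')" using c by (simp add: M.M.r_neg2)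
      finally show ?thesis .
    qed
    have "z \<oplus>\<^bsub>M\<^esub> (\<ominus>\<^bsub>M\<^esub> z') \<in> N"
      using za(1) submodule_uminus[OF N(1) z'(1)] N(1)[unfolded submodule_iff[OF M]] by blast
    moreover have "h \<oplus>\<^bsub>M\<^esub> (\<ominus>\<^bsub>M\<^esub> ?k) \<in> H"
      using h submodule_uminus[OF conjunct1[OF H] z'(3)] conjunct1[OF H, unfolded submodule_iff[OF M]]
      by blast
    ultimately have "h \<oplus>\<^bsub>M\<^esub> (\<ominus>\<^bsub>M\<^esub> ?k) \<in> L"
      using hk S1(2) L unfolding generates_def by auto
    then have "(h \<oplus>\<^bsub>M\<^esub> (\<ominus>\<^bsub>M\<^esub> ?k)) \<oplus>\<^bsub>M\<^esub> ?k \<in> L"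
      using z'(2) L(1)[unfolded submodule_iff[OF M]] by blast
    moreover have "(h \<oplus>\<^bsub>M\<^esub> (\<ominus>\<^bsub>M\<^esub> ?k)) \<oplus>\<^bsub>M\<^esub> ?k = h"
    proof -
      have "?k \<in> carrier M" "h \<in> carrier M" using c za(3) by auto
      then show ?thesis by (simp add: M.M.a_assoc M.M.l_neg)
    qed
    ultimately show "h \<in> L" by simp
  qed
  moreover have "?S \<subseteq> H" using S1(2) y(2) unfolding generates_def by auto
  ultimately have "generates A M ?S H" unfolding generates_def by blast
  then show "\<exists>S. finite S \<and> generates A M S H" using S0(1) S1(1) by (intro exI[of _ ?S]) simp
qed

lemma fg_module_noetherian:
  fixes M :: "('a, 'm) module"
  assumes A: "noetherian_below A (regular_module A) (carrier A)" and M: "fg_left_module A M"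
  shows "noetherian_below A M (carrier M)"
proof -
  have M': "left_module A M" using M unfolding fg_left_module_def by blast
  interpret M: left_module A M by fact
  obtain S where S: "finite S" "S \<subseteq> carrier M" "\<And>H. \<lbrakk>submodule H A M; S \<subseteq> H\<rbrakk> \<Longrightarrow> H = carrier M"
    using M unfolding fg_left_module_def by blast
  from S(1,2) have "\<exists>N. submodule N A M \<and> S \<subseteq> N \<and> noetherian_below A M N"
  proof (induction S rule: finite_induct)
    case empty
    have "submodule {\<zero>\<^bsub>M\<^esub>} A M" unfolding submodule_iff[OF M'] by (auto simp: M.smult_zero)
    moreover have "noetherian_below A M {\<zero>\<^bsub>M\<^esub>}"
      unfolding noetherian_below_def generates_def submodule_iff[OF M'] by (auto intro!: exI[of _ "{}"])
    ultimately show ?case by blast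
  next
    case (insert x S)
    then obtain N where N: "submodule N A M" "S \<subseteq> N" "noetherian_below A M N" by auto
    note N' = N(1)[unfolded submodule_iff[OF M']]
    have x: "x \<in> carrier M" using insert by auto
    let ?N = "{y \<oplus>\<^bsub>M\<^esub> a \<odot>\<^bsub>M\<^esub> x | y a. y \<in> N \<and> a \<in> carrier A}"
    have zx: "\<zero>\<^bsub>A\<^esub> \<odot>\<^bsub>M\<^esub> x = \<zero>\<^bsub>M\<^esub>" using x by (rule M.zero_smult)
    have NN: "y \<in> ?N" if "y \<in> N" for y
    proof -
      have "y = y \<oplus>\<^bsub>M\<^esub> \<zero>\<^bsub>A\<^esub> \<odot>\<^bsub>M\<^esub> x" using that N' by (auto simp: zx)
      then show ?thesis using that M.R.zero_closed by blast
    qed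
    have "x = \<zero>\<^bsub>M\<^esub> \<oplus>\<^bsub>M\<^esub> \<one>\<^bsub>A\<^esub> \<odot>\<^bsub>M\<^esub> x" using x by (simp add: M.smult_one)
    then have xN: "x \<in> ?N" using N' M.R.one_closed by blast
    have "submodule ?N A M"
      unfolding submodule_iff[OF M']
    proof (intro conjI ballI)
      show "?N \<subseteq> carrier M" using N' x by (auto simp: M.smult_closed)
      show "\<zero>\<^bsub>M\<^esub> \<in> ?N" using NN N' by blast
    next
      fix u v assume u: "u \<in> ?N" and v: "v \<in> ?N"
      obtain y a where ya: "y \<in> N" "a \<in> carrier A" "u = y \<oplus>\<^bsub>M\<^esub> a \<odot>\<^bsub>M\<^esub> x" using u by blast
      obtain z b where zb: "z \<in> N" "b \<in> carrier A" "v = z \<oplus>\<^bsub>M\<^esub> b \<odot>\<^bsub>M\<^esub> x" using v by blast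
      have "u \<oplus>\<^bsub>M\<^esub> v = (y \<oplus>\<^bsub>M\<^esub> z) \<oplus>\<^bsub>M\<^esub> (a \<oplus>\<^bsub>A\<^esub> b) \<odot>\<^bsub>M\<^esub> x"
        using N' x ya zb by (simp add: M.smult_l_distr M.smult_closed M.M.a_ac subset_iff)
      moreover have "y \<oplus>\<^bsub>M\<^esub> z \<in> N" "a \<oplus>\<^bsub>A\<^esub> b \<in> carrier A" using N' ya zb by auto
      ultimately show "u \<oplus>\<^bsub>M\<^esub> v \<in> ?N" by blast
    next
      fix c u assume c: "c \<in> carrier A" and "u \<in> ?N"
      then obtain y a where ya: "y \<in> N" "a \<in> carrier A" "u = y \<oplus>\<^bsub>M\<^esub> a \<odot>\<^bsub>M\<^esub> x" by blast
      then have "c \<odot>\<^bsub>M\<^esub> u = c \<odot>\<^bsub>M\<^esub> y \<oplus>\<^bsub>M\<^esub> (c \<otimes>\<^bsub>A\<^esub> a) \<odot>\<^bsub>M\<^esub> x"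
        using N' x c by (simp add: M.smult_r_distr M.smult_assoc1 M.smult_closed subset_iff)
      moreover have "c \<odot>\<^bsub>M\<^esub> y \<in> N" "c \<otimes>\<^bsub>A\<^esub> a \<in> carrier A" using N' ya c by auto
      ultimately show "c \<odot>\<^bsub>M\<^esub> u \<in> ?N" by blast
    qed
    moreover have "insert x S \<subseteq> ?N" using xN NN N(2) by blast
    ultimately show ?case using noetherian_below_adjoin[OF M' N(1,3) x A] by blast
  qed
  then show ?thesis using S(3) by auto
qed

lemma submodule_of_fg_is_fg:
  fixes M :: "('a, 'm) module"
  assumes "finite_dimensional_algebra K A" and M: "fg_left_module A M" and H: "submodule H A M"
  shows "fg_left_module A (M\<lparr>carrier := H\<rparr>)"
proof -
  have M': "left_module A M" using M unfolding fg_left_module_def by blast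
  note MH = submodule_is_left_module[OF M' H]
  have HM: "H \<subseteq> carrier M" using H unfolding submodule_iff[OF M'] by blast
  obtain S where "finite S" "generates A M S H"
    using fg_module_noetherian[OF left_ideal_finitely_generated[OF assms(1)] M, unfolded noetherian_below_def,
        rule_format, OF conjI[OF H HM]] by blast
  then have S: "finite S" "S \<subseteq> H" "\<And>L. \<lbrakk>submodule L A M; S \<subseteq> L\<rbrakk> \<Longrightarrow> H \<subseteq> L"
    unfolding generates_def by auto
  have "L = H" if L: "submodule L A (M\<lparr>carrier := H\<rparr>)" "S \<subseteq> L" for L
  proof -
    have "L \<subseteq> H" "submodule L A M"
      using L(1) HM unfolding submodule_iff[OF M'] submodule_iff[OF MH] by auto
    then show ?thesis using S(3) L(2) by blast
  qed
  then show ?thesis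
    unfolding fg_left_module_def using MH S(1,2) by auto
qed

section \<open>Torsion submodules\<close>

text \<open>Passing to the bidual only records the values of an element under all functionals. Elements of the
  dual are normalised outside \<open>M\<close>, so an arbitrary functional is restricted before it is used.\<close>

lemma torsion_submodule_carrier:
  fixes M :: "('a, 'm) module"
  assumes M: "left_module A M"
  shows "carrier (torsion_submodule A M) =
    {m \<in> carrier M. \<forall>f\<in>left_module_hom A M (regular_module A). f m = \<zero>\<^bsub>A\<^esub>}"
proof -
  interpret M: left_module A M by fact
  let ?D = "carrier (dual_module A M)"
  have D: "?D = left_module_hom A M (regular_module A) \<inter> extensional (carrier M)"
    by (simp add: dual_module_def)
  have restr: "restrict f (carrier M) \<in> ?D" if "f \<in> left_module_hom A M (regular_module A)" for f
    using left_module_homD[OF that] M.smult_closed by (auto simp: D intro!: left_module_homI)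
  have "carrier (torsion_submodule A M) = {m \<in> carrier M. \<forall>f\<in>?D. f m = \<zero>\<^bsub>A\<^esub>}"
  proof -
    have z: "\<zero>\<^bsub>double_dual A M\<^esub> = (\<lambda>f\<in>?D. \<zero>\<^bsub>A\<^esub>)"
      by (simp add: double_dual_def dual_module_def opposite_ring_def)
    have "evaluation_map A M m = \<zero>\<^bsub>double_dual A M\<^esub> \<longleftrightarrow> (\<forall>f\<in>?D. f m = \<zero>\<^bsub>A\<^esub>)" for m
      unfolding z evaluation_map_def by (auto simp: fun_eq_iff restrict_def)
    then show ?thesis by (simp add: torsion_submodule_def a_kernel_def')
  qed
  also have "\<dots> = {m \<in> carrier M. \<forall>f\<in>left_module_hom A M (regular_module A). f m = \<zero>\<^bsub>A\<^esub>}"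
    (is "?L = ?R")
  proof
    show "?L \<subseteq> ?R"
    proof safe
      fix m f assume m: "m \<in> carrier M" and f: "f \<in> left_module_hom A M (regular_module A)"
        and "\<forall>f\<in>?D. f m = \<zero>\<^bsub>A\<^esub>"
      then have "restrict f (carrier M) m = \<zero>\<^bsub>A\<^esub>" using restr by blast
      then show "f m = \<zero>\<^bsub>A\<^esub>" using m by simp
    qed
    show "?R \<subseteq> ?L" using D by auto
  qed
  finally show ?thesis .
qed

lemma torsion_submodule_is_submodule:
  fixes M :: "('a, 'm) module"
  assumes M: "left_module A M"
  shows "submodule (carrier (torsion_submodule A M)) A M"
proof -
  interpret M: left_module A M by fact
  note reg = regular_module_left_module[OF M.R.ring_axioms]
  have "f (x \<oplus>\<^bsub>M\<^esub> y) = \<zero>\<^bsub>A\<^esub>" if "f \<in> left_module_hom A M (regular_module A)" "f x = \<zero>\<^bsub>A\<^esub>" "f y = \<zero>\<^bsub>A\<^esub>"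
    "x \<in> carrier M" "y \<in> carrier M" for f x y
    using hom_add[OF that(1,4,5)] that(2,3) by (simp add: regular_module_simps)
  moreover have "f (a \<odot>\<^bsub>M\<^esub> x) = \<zero>\<^bsub>A\<^esub>" if "f \<in> left_module_hom A M (regular_module A)" "f x = \<zero>\<^bsub>A\<^esub>"
    "x \<in> carrier M" "a \<in> carrier A" for f x a
    using hom_smult[OF that(1,4,3)] that(2,4) by (simp add: regular_module_simps)
  moreover have "f \<zero>\<^bsub>M\<^esub> = \<zero>\<^bsub>A\<^esub>" if "f \<in> left_module_hom A M (regular_module A)" for f
    using hom_zero[OF M reg that] by (simp add: regular_module_simps)
  ultimately show ?thesis
    unfolding submodule_iff[OF M] torsion_submodule_carrier[OF M] by (simp add: M.smult_closed subset_iff)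
qed

lemma torsion_submodule_eq:
  "torsion_submodule A M = M\<lparr>carrier := carrier (torsion_submodule A M)\<rparr>"
  by (simp add: torsion_submodule_def)

text \<open>A functional on the torsion submodule, followed by \<open>e\<close>, extends to a map from \<open>M\<close> to \<open>I0\<close> because \<open>I0\<close>
  is injective. Since \<open>I0\<close> is projective as well, that extension is determined by functionals on \<open>M\<close>,
  and these vanish on torsion elements. Such an \<open>I0\<close> containing \<open>A\<close> exists when the dominant dimension
  is positive.\<close>

lemma hom_from_torsion_to_projective_zero:
  fixes M I0 Q :: "'a umodule"
  assumes M: "left_module A M"
    and I0: "fg_left_module A I0" "injective_module A I0" "projective_module A I0"
    and e: "e \<in> left_module_hom A (regular_module A) I0" "inj_on e (carrier A)"
    and Q: "fg_left_module A Q" "projective_module A Q"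
    and f: "f \<in> left_module_hom A (torsion_submodule A M) Q"
    and u: "u \<in> carrier (torsion_submodule A M)"
  shows "f u = \<zero>\<^bsub>Q\<^esub>"
proof -
  interpret M: left_module A M by fact
  let ?U = "torsion_submodule A M"
  note reg = regular_module_left_module[OF M.R.ring_axioms]
  have I0': "left_module A I0" using I0(1) unfolding fg_left_module_def by blast
  have U: "left_module A ?U"
    using submodule_is_left_module[OF M torsion_submodule_is_submodule[OF M]]
    by (simp add: torsion_submodule_eq[symmetric])
  have UM: "carrier ?U \<subseteq> carrier M"
    using torsion_submodule_carrier[OF M] by auto
  have incl: "(\<lambda>x. x) \<in> left_module_hom A ?U M"
    using UM by (subst torsion_submodule_eq) (auto intro!: left_module_homI)
  have zeroU: "\<zero>\<^bsub>?U\<^esub> = \<zero>\<^bsub>M\<^esub>" by (simp add: torsion_submodule_def)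
  have "\<phi> u = \<zero>\<^bsub>A\<^esub>" if \<phi>: "\<phi> \<in> left_module_hom A ?U (regular_module A)" for \<phi>
  proof -
    note e\<phi> = hom_comp[OF \<phi> e(1)]
    have ker: "e (\<phi> x) = \<zero>\<^bsub>I0\<^esub>" if "x = \<zero>\<^bsub>M\<^esub>" for x
      using hom_zero[OF U I0' e\<phi>] that zeroU by simp
    obtain h where h: "h \<in> left_module_hom A M I0" "\<And>x. x \<in> carrier ?U \<Longrightarrow> h x = e (\<phi> x)"
      using injective_extension[OF U M I0(2) incl e\<phi> ker] by auto
    have "h u = \<zero>\<^bsub>I0\<^esub>"
      using u functionals_detect_projective[OF M I0(1,3) _ _ h(1), of u]
      by (auto simp: torsion_submodule_carrier[OF M])
    then have "e (\<phi> u) = e \<zero>\<^bsub>A\<^esub>"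
      using h(2)[OF u] hom_zero[OF reg I0' e(1)] by (simp add: regular_module_simps)
    moreover have "\<phi> u \<in> carrier A" using hom_closed[OF \<phi> u] by (simp add: regular_module_simps)
    ultimately show ?thesis using inj_onD[OF e(2)] by auto
  qed
  then show ?thesis
    using functionals_detect_projective[OF U Q u _ f] by blast
qed

section \<open>Vanishing of extension groups\<close>

lemma hom_lift_injective:
  assumes M: "left_module A M" and N: "left_module A N"
    and e: "e \<in> left_module_hom A M N" "inj_on e (carrier M)"
    and f: "f \<in> left_module_hom A P N" "f ` carrier P \<subseteq> e ` carrier M" and P: "left_module A P"
  shows "\<exists>h\<in>left_module_hom A P M. \<forall>x\<in>carrier P. e (h x) = f x"
proof -
  interpret M: left_module A M by fact
  interpret P: left_module A P by fact
  define h where "h = (\<lambda>x. the_inv_into (carrier M) e (f x))"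
  have im: "f x \<in> e ` carrier M" if "x \<in> carrier P" for x using f(2) that by blast
  have hM: "h x \<in> carrier M" and eh: "e (h x) = f x" if "x \<in> carrier P" for x
    unfolding h_def
    using the_inv_into_into[OF e(2) im[OF that] subset_refl] f_the_inv_into_f[OF e(2) im[OF that]] by auto
  have "h \<in> left_module_hom A P M"
  proof (rule left_module_homI, goal_cases)
    case (1 x) then show ?case by (rule hM)
  next
    case (2 x y)
    then show ?case
      by (intro inj_onD[OF e(2)]) (simp_all add: hM eh hom_add[OF e(1)] hom_add[OF f(1)])
  next
    case (3 a x)
    then show ?case
      by (intro inj_onD[OF e(2)])
        (simp_all add: hM eh hom_smult[OF e(1)] hom_smult[OF f(1)] M.smult_closed P.smult_closed)
  qed
  with eh show ?thesis by blast
qed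

text \<open>Dimension shifting in the double complex of maps from \<open>P i\<close> to \<open>I j\<close>. Write \<open>C j\<close> for the kernel of
  \<open>\<delta> j\<close>, which is the \<open>j\<close>-th cosyzygy of \<open>C 0\<close>. The conclusion says that the extension group of degree
  \<open>i + 1\<close> with coefficients in \<open>C j\<close> vanishes. A cocycle into \<open>C j\<close> extends along \<open>d i\<close> to a map \<open>\<psi>\<close> into
  the injective module \<open>I j\<close>, and \<open>\<delta> j\<close> after \<open>\<psi>\<close> is a cocycle of degree \<open>i\<close> into \<open>C (j + 1)\<close>. In degree
  0 it vanishes by \<open>bottom\<close>. Otherwise it is a coboundary by induction, a lift of its primitive to \<open>I j\<close>
  exists because \<open>P\<close> is projective, and correcting \<open>\<psi>\<close> by this lift moves it into \<open>C j\<close>. The sum of the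
  degrees is preserved, so only the terms \<open>I j\<close> with \<open>j < n\<close> are met in degree 0.\<close>

lemma cocycle_lifting:
  fixes P I :: "nat \<Rightarrow> 'a umodule"
  assumes P: "\<And>i. projective_module A (P i)"
    and d: "\<And>i. d i \<in> left_module_hom A (P (Suc i)) (P i)"
    and exP: "\<And>i. d (Suc i) ` carrier (P (Suc (Suc i))) = a_kernel (P (Suc i)) (P i) (d i)"
    and I: "\<And>j. injective_module A (I j)"
    and \<delta>: "\<And>j. \<delta> j \<in> left_module_hom A (I j) (I (Suc j))"
    and exI: "\<And>j. \<delta> j ` carrier (I j) = a_kernel (I (Suc j)) (I (Suc (Suc j))) (\<delta> (Suc j))"
    and bottom: "\<And>j \<chi> x. \<lbrakk>j < n; \<chi> \<in> left_module_hom A (P 0) (I j);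
      \<And>x. x \<in> carrier (P (Suc 0)) \<Longrightarrow> \<chi> (d 0 x) = \<zero>\<^bsub>I j\<^esub>; x \<in> carrier (P 0)\<rbrakk> \<Longrightarrow> \<chi> x = \<zero>\<^bsub>I j\<^esub>"
    and "Suc i + j < n"
    and "\<chi> \<in> left_module_hom A (P (Suc i)) (I j)"
    and "\<And>x. x \<in> carrier (P (Suc (Suc i))) \<Longrightarrow> \<chi> (d (Suc i) x) = \<zero>\<^bsub>I j\<^esub>"
    and "\<And>x. x \<in> carrier (P (Suc i)) \<Longrightarrow> \<delta> j (\<chi> x) = \<zero>\<^bsub>I (Suc j)\<^esub>"
  shows "\<exists>h\<in>left_module_hom A (P i) (I j).
    (\<forall>x\<in>carrier (P (Suc i)). h (d i x) = \<chi> x) \<and> (\<forall>y\<in>carrier (P i). \<delta> j (h y) = \<zero>\<^bsub>I (Suc j)\<^esub>)"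
  using assms(8-)
proof (induction i arbitrary: j \<chi>)
  case 0
  have P': "left_module A (P i)" for i using P unfolding projective_module_def by blast
  have I': "left_module A (I i)" for i using I unfolding injective_module_def by blast
  have ker: "\<chi> x = \<zero>\<^bsub>I j\<^esub>" if "x \<in> carrier (P (Suc 0))" "d 0 x = \<zero>\<^bsub>P 0\<^esub>" for x
  proof -
    have "x \<in> d (Suc 0) ` carrier (P (Suc (Suc 0)))"
      unfolding exP a_kernel_def' using that by simp
    then show ?thesis using 0(3) by auto
  qed
  obtain \<psi> where \<psi>: "\<psi> \<in> left_module_hom A (P 0) (I j)" "\<And>x. x \<in> carrier (P (Suc 0)) \<Longrightarrow> \<psi> (d 0 x) = \<chi> x"
    using injective_extension[OF P' P' I d 0(2) ker] by auto
  have "\<delta> j (\<psi> y) = \<zero>\<^bsub>I (Suc j)\<^esub>" if y: "y \<in> carrier (P 0)" for y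
  proof (rule bottom[OF _ hom_comp[OF \<psi>(1) \<delta>] _ y])
    show "Suc j < n" using 0(1) by simp
    show "\<delta> j (\<psi> (d 0 x)) = \<zero>\<^bsub>I (Suc j)\<^esub>" if "x \<in> carrier (P (Suc 0))" for x
      using \<psi>(2)[OF that] 0(4)[OF that] by simp
  qed
  with \<psi> show ?case by blast
next
  case (Suc i)
  have P': "left_module A (P i)" for i using P unfolding projective_module_def by blast
  have I': "left_module A (I i)" for i using I unfolding injective_module_def by blast
  interpret Ij: left_module A "I j" by (rule I')
  interpret Ij': left_module A "I (Suc j)" by (rule I')
  let ?d = "d (Suc i)"
  have ker: "\<chi> x = \<zero>\<^bsub>I j\<^esub>" if "x \<in> carrier (P (Suc (Suc i)))" "?d x = \<zero>\<^bsub>P (Suc i)\<^esub>" for x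
  proof -
    have "x \<in> d (Suc (Suc i)) ` carrier (P (Suc (Suc (Suc i))))"
      unfolding exP a_kernel_def' using that by simp
    then show ?thesis using Suc.prems(3) by auto
  qed
  obtain \<psi> where \<psi>: "\<psi> \<in> left_module_hom A (P (Suc i)) (I j)"
    "\<And>x. x \<in> carrier (P (Suc (Suc i))) \<Longrightarrow> \<psi> (?d x) = \<chi> x"
    using injective_extension[OF P' P' I d Suc.prems(2) ker] by auto
  have "\<exists>k\<in>left_module_hom A (P i) (I (Suc j)).
    (\<forall>x\<in>carrier (P (Suc i)). k (d i x) = \<delta> j (\<psi> x)) \<and>
    (\<forall>y\<in>carrier (P i). \<delta> (Suc j) (k y) = \<zero>\<^bsub>I (Suc (Suc j))\<^esub>)"
  proof (rule Suc.IH)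
    show "Suc i + Suc j < n" using Suc.prems(1) by simp
    show "(\<lambda>x. \<delta> j (\<psi> x)) \<in> left_module_hom A (P (Suc i)) (I (Suc j))"
      by (rule hom_comp[OF \<psi>(1) \<delta>])
    show "\<delta> j (\<psi> (?d x)) = \<zero>\<^bsub>I (Suc j)\<^esub>" if "x \<in> carrier (P (Suc (Suc i)))" for x
      using \<psi>(2)[OF that] Suc.prems(4)[OF that] by simp
    show "\<delta> (Suc j) (\<delta> j (\<psi> x)) = \<zero>\<^bsub>I (Suc (Suc j))\<^esub>" if "x \<in> carrier (P (Suc i))" for x
    proof -
      have "\<delta> j (\<psi> x) \<in> \<delta> j ` carrier (I j)" using hom_closed[OF \<psi>(1) that] by blast
      then show ?thesis unfolding exI a_kernel_def' by simp
    qed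
  qed
  then obtain k where k: "k \<in> left_module_hom A (P i) (I (Suc j))"
    "\<And>x. x \<in> carrier (P (Suc i)) \<Longrightarrow> k (d i x) = \<delta> j (\<psi> x)"
    "\<And>y. y \<in> carrier (P i) \<Longrightarrow> \<delta> (Suc j) (k y) = \<zero>\<^bsub>I (Suc (Suc j))\<^esub>"
    by auto
  have im: "k y \<in> \<delta> j ` carrier (I j)" if "y \<in> carrier (P i)" for y
    unfolding exI a_kernel_def' using hom_closed[OF k(1) that] k(3)[OF that] by simp
  obtain l where l: "l \<in> left_module_hom A (P i) (I j)"
    "\<And>y. y \<in> carrier (P i) \<Longrightarrow> \<delta> j (l y) = k y"
    using projective_lift[OF P I' I' \<delta> k(1) im] by auto
  let ?h = "\<lambda>x. \<psi> x \<ominus>\<^bsub>I j\<^esub> l (d i x)"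
  note ld = hom_comp[OF d l(1)]
  have h: "?h \<in> left_module_hom A (P (Suc i)) (I j)"
    by (rule hom_diff_map[OF P' I' \<psi>(1) ld])
  have "?h (?d x) = \<chi> x" if x: "x \<in> carrier (P (Suc (Suc i)))" for x
  proof -
    have "?d x \<in> ?d ` carrier (P (Suc (Suc i)))" using x by blast
    then have "d i (?d x) = \<zero>\<^bsub>P i\<^esub>" unfolding exP a_kernel_def' by simp
    then have "l (d i (?d x)) = \<zero>\<^bsub>I j\<^esub>" using hom_zero[OF P' I' l(1)] by simp
    then show ?thesis
      using \<psi>(2)[OF x] hom_closed[OF Suc.prems(2) x] by (simp add: a_minus_def)
  qed
  moreover have "\<delta> j (?h y) = \<zero>\<^bsub>I (Suc j)\<^esub>" if y: "y \<in> carrier (P (Suc i))" for y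
  proof -
    have "\<delta> j (?h y) = \<delta> j (\<psi> y) \<ominus>\<^bsub>I (Suc j)\<^esub> \<delta> j (l (d i y))"
      by (rule hom_diff[OF I' I' \<delta> hom_closed[OF \<psi>(1) y] hom_closed[OF ld y]])
    also have "\<dots> = \<delta> j (\<psi> y) \<ominus>\<^bsub>I (Suc j)\<^esub> \<delta> j (\<psi> y)"
      using l(2)[OF hom_closed[OF d y]] k(2)[OF y] by simp
    also have "\<dots> = \<zero>\<^bsub>I (Suc j)\<^esub>"
      using hom_closed[OF \<delta> hom_closed[OF \<psi>(1) y]] by (simp add: a_minus_def Ij'.M.r_neg)
    finally show ?thesis .
  qed
  ultimately show ?case using h by (intro bexI[of _ ?h] conjI ballI)
qed

text \<open>The complex of maps from the resolution to a finitely generated projective \<open>Q\<close> is exact in all degrees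
  below \<open>n\<close>. If the resolution has length \<open>p < n\<close>, these are all the degrees in which it lives, and taking
  for \<open>Q\<close> the terms of the resolution itself yields a contraction, built downwards from degree \<open>p\<close>. Hence
  \<open>d 0\<close> is onto, and the resolved module, being its cokernel, is zero.\<close>

lemma resolved_module_zero:
  fixes U :: "'a umodule"
  assumes A: "ring A" and U: "left_module A U"
    and res: "projective_resolution A U P d \<epsilon>" and len: "\<And>i. i > p \<Longrightarrow> carrier (P i) = {\<zero>\<^bsub>P i\<^esub>}"
    and cores: "minimal_injective_coresolution A (regular_module A) I \<delta> e"
    and proj: "\<And>j. j < n \<Longrightarrow> projective_module A (I j)" and pn: "p < n"
    and van: "\<And>Q f u. \<lbrakk>fg_left_module A Q; projective_module A Q; f \<in> left_module_hom A U Q;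
      u \<in> carrier U\<rbrakk> \<Longrightarrow> f u = \<zero>\<^bsub>Q\<^esub>"
  shows "carrier U = {\<zero>\<^bsub>U\<^esub>}"
proof -
  note r = res[unfolded projective_resolution_def] and c = cores[unfolded minimal_injective_coresolution_def]
  have Pfg: "fg_left_module A (P i)" and Ppr: "projective_module A (P i)" for i using r by auto
  have P': "left_module A (P i)" for i using Ppr unfolding projective_module_def by blast
  have d: "d i \<in> left_module_hom A (P (Suc i)) (P i)" for i using r by auto
  have \<epsilon>: "\<epsilon> \<in> left_module_hom A (P 0) U" "\<epsilon> ` carrier (P 0) = carrier U" using r by auto
  have d0: "d 0 ` carrier (P (Suc 0)) = a_kernel (P 0) U \<epsilon>" using r by simp
  have exP: "d (Suc i) ` carrier (P (Suc (Suc i))) = a_kernel (P (Suc i)) (P i) (d i)" for i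
    using r by auto
  have Ifg: "fg_left_module A (I j)" and Iinj: "injective_module A (I j)" for j using c by auto
  have I': "left_module A (I j)" for j using Iinj unfolding injective_module_def by blast
  have \<delta>: "\<delta> j \<in> left_module_hom A (I j) (I (Suc j))" for j using c by auto
  have exI: "\<delta> j ` carrier (I j) = a_kernel (I (Suc j)) (I (Suc (Suc j))) (\<delta> (Suc j))" for j
    using c by auto
  have e: "e \<in> left_module_hom A (regular_module A) (I 0)" "inj_on e (carrier (regular_module A))"
    using c by auto
  have ex0: "e ` carrier (regular_module A) = a_kernel (I 0) (I (Suc 0)) (\<delta> 0)" using c by simp
  note reg = regular_module_left_module[OF A]
  have dd: "d i (d (Suc i) x) = \<zero>\<^bsub>P i\<^esub>" if "x \<in> carrier (P (Suc (Suc i)))" for i x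
  proof -
    have "d (Suc i) x \<in> d (Suc i) ` carrier (P (Suc (Suc i)))" using that by blast
    then show ?thesis unfolding exP a_kernel_def' by simp
  qed
  (* A cocycle of degree 0 factors through the cokernel U of d 0. *)
  have bottom: "\<chi> x = \<zero>\<^bsub>Q\<^esub>"
    if Q: "fg_left_module A Q" "projective_module A Q" and \<chi>: "\<chi> \<in> left_module_hom A (P 0) Q"
      and co: "\<And>x. x \<in> carrier (P (Suc 0)) \<Longrightarrow> \<chi> (d 0 x) = \<zero>\<^bsub>Q\<^esub>" and x: "x \<in> carrier (P 0)"
    for Q \<chi> x
  proof -
    have Q': "left_module A Q" using Q unfolding fg_left_module_def by blast
    have ker: "\<chi> y = \<zero>\<^bsub>Q\<^esub>" if "y \<in> carrier (P 0)" "\<epsilon> y = \<zero>\<^bsub>U\<^esub>" for y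
    proof -
      have "y \<in> d 0 ` carrier (P (Suc 0))" unfolding d0 a_kernel_def' using that by simp
      then show ?thesis using co by auto
    qed
    show ?thesis
    proof (rule hom_factor_through_image[OF P' U Q' \<epsilon>(1) \<chi> ker])
      fix f' assume f': "f' \<in> left_module_hom A (U\<lparr>carrier := \<epsilon> ` carrier (P 0)\<rparr>) Q"
        "\<And>x. x \<in> carrier (P 0) \<Longrightarrow> f' (\<epsilon> x) = \<chi> x"
      have "f' \<in> left_module_hom A U Q" using f'(1) by (simp add: \<epsilon>(2))
      then have "f' (\<epsilon> x) = \<zero>\<^bsub>Q\<^esub>" by (rule van[OF Q]) (rule hom_closed[OF \<epsilon>(1) x])
      then show "\<chi> x = \<zero>\<^bsub>Q\<^esub>" using f'(2)[OF x] by simp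
    qed
  qed
  (* A is the kernel of \<delta> 0, so the double complex in row 0 computes cohomology with coefficients in A. *)
  have ext_A: "\<exists>h\<in>left_module_hom A (P i) (regular_module A). \<forall>x\<in>carrier (P (Suc i)). h (d i x) = \<phi> x"
    if i: "Suc i < n" and \<phi>: "\<phi> \<in> left_module_hom A (P (Suc i)) (regular_module A)"
      and co: "\<And>x. x \<in> carrier (P (Suc (Suc i))) \<Longrightarrow> \<phi> (d (Suc i) x) = \<zero>\<^bsub>A\<^esub>" for i \<phi>
  proof -
    have e0: "e \<zero>\<^bsub>A\<^esub> = \<zero>\<^bsub>I 0\<^esub>" using hom_zero[OF reg I' e(1)] by (simp add: regular_module_simps)
    have "\<exists>h\<in>left_module_hom A (P i) (I 0). (\<forall>x\<in>carrier (P (Suc i)). h (d i x) = e (\<phi> x)) \<and>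
      (\<forall>y\<in>carrier (P i). \<delta> 0 (h y) = \<zero>\<^bsub>I (Suc 0)\<^esub>)"
    proof (rule cocycle_lifting[of A P d I \<delta> n, OF Ppr d exP Iinj \<delta> exI])
      show "\<chi> x = \<zero>\<^bsub>I j\<^esub>" if "j < n" "\<chi> \<in> left_module_hom A (P 0) (I j)"
        "\<And>x. x \<in> carrier (P (Suc 0)) \<Longrightarrow> \<chi> (d 0 x) = \<zero>\<^bsub>I j\<^esub>" "x \<in> carrier (P 0)" for j \<chi> x
        by (rule bottom[OF Ifg proj[OF that(1)] that(2-4)])
      show "Suc i + 0 < n" using i by simp
      show "(\<lambda>x. e (\<phi> x)) \<in> left_module_hom A (P (Suc i)) (I 0)" by (rule hom_comp[OF \<phi> e(1)])
      show "e (\<phi> (d (Suc i) x)) = \<zero>\<^bsub>I 0\<^esub>" if "x \<in> carrier (P (Suc (Suc i)))" for x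
        using co[OF that] e0 by simp
      show "\<delta> 0 (e (\<phi> x)) = \<zero>\<^bsub>I (Suc 0)\<^esub>" if "x \<in> carrier (P (Suc i))" for x
      proof -
        have "e (\<phi> x) \<in> e ` carrier (regular_module A)" using hom_closed[OF \<phi> that] by blast
        then show ?thesis unfolding ex0 a_kernel_def' by simp
      qed
    qed
    then obtain h where h: "h \<in> left_module_hom A (P i) (I 0)"
      "\<And>x. x \<in> carrier (P (Suc i)) \<Longrightarrow> h (d i x) = e (\<phi> x)"
      "\<And>y. y \<in> carrier (P i) \<Longrightarrow> \<delta> 0 (h y) = \<zero>\<^bsub>I (Suc 0)\<^esub>" by auto
    have "h ` carrier (P i) \<subseteq> e ` carrier (regular_module A)"
      unfolding ex0 a_kernel_def' using hom_closed[OF h(1)] h(3) by auto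
    then obtain h' where h': "h' \<in> left_module_hom A (P i) (regular_module A)"
      "\<And>y. y \<in> carrier (P i) \<Longrightarrow> e (h' y) = h y"
      using hom_lift_injective[OF reg I' e h(1) _ P'] by auto
    have "h' (d i x) = \<phi> x" if x: "x \<in> carrier (P (Suc i))" for x
    proof (rule inj_onD[OF e(2)])
      show "e (h' (d i x)) = e (\<phi> x)" using h'(2)[OF hom_closed[OF d x]] h(2)[OF x] by simp
    qed (use hom_closed[OF h'(1) hom_closed[OF d x]] hom_closed[OF \<phi> x] in auto)
    with h'(1) show ?thesis by (intro bexI[of _ h'] ballI)
  qed
  have ext_Q: "\<exists>h\<in>left_module_hom A (P i) Q. \<forall>x\<in>carrier (P (Suc i)). h (d i x) = \<chi> x"
    if i: "Suc i < n" and Q: "fg_left_module A Q" "projective_module A Q"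
      and \<chi>: "\<chi> \<in> left_module_hom A (P (Suc i)) Q"
      and co: "\<And>x. x \<in> carrier (P (Suc (Suc i))) \<Longrightarrow> \<chi> (d (Suc i) x) = \<zero>\<^bsub>Q\<^esub>" for i Q \<chi>
  proof (rule extension_to_projective[OF P' P' Q \<chi>])
    fix \<phi> assume \<phi>: "\<phi> \<in> left_module_hom A Q (regular_module A)"
    have Q': "left_module A Q" using Q unfolding fg_left_module_def by blast
    have co': "\<phi> (\<chi> (d (Suc i) x)) = \<zero>\<^bsub>A\<^esub>" if "x \<in> carrier (P (Suc (Suc i)))" for x
      using co[OF that] hom_zero[OF Q' reg \<phi>] by (simp add: regular_module_simps)
    show "\<exists>h\<in>left_module_hom A (P i) (regular_module A). \<forall>x\<in>carrier (P (Suc i)). h (d i x) = \<phi> (\<chi> x)"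
      by (rule ext_A[OF i hom_comp[OF \<chi> \<phi>] co'])
  qed
  (* The identity minus d (k+1) s is a cocycle in degree k+1, and a primitive of it is the next
     component h of the contraction. At k = p the zero map serves because P (p+1) = 0. *)
  have contraction: "\<exists>s\<in>left_module_hom A (P k) (P (Suc k)). \<forall>x\<in>carrier (P (Suc k)). d k (s (d k x)) = d k x"
    if "k \<le> p" for k
    using that
  proof (induction k rule: inc_induct)
    case base
    interpret Pp: left_module A "P p" by (rule P')
    have "d p (\<zero>\<^bsub>P (Suc p)\<^esub>) = d p x" if "x \<in> carrier (P (Suc p))" for x
      using that len[of "Suc p"] by simp
    then show ?case by (intro bexI[OF _ hom_zero_map[OF P']]) auto
  next
    case (step k)
    interpret Pk: left_module A "P k" by (rule P')
    interpret PSk: left_module A "P (Suc k)" by (rule P')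
    obtain s where s: "s \<in> left_module_hom A (P (Suc k)) (P (Suc (Suc k)))"
      "\<And>x. x \<in> carrier (P (Suc (Suc k))) \<Longrightarrow> d (Suc k) (s (d (Suc k) x)) = d (Suc k) x"
      using step.IH by auto
    let ?\<chi> = "\<lambda>x. x \<ominus>\<^bsub>P (Suc k)\<^esub> d (Suc k) (s x)"
    have \<chi>: "?\<chi> \<in> left_module_hom A (P (Suc k)) (P (Suc k))"
      by (rule hom_diff_map[OF P' P' hom_ident hom_comp[OF s(1) d]])
    have "?\<chi> (d (Suc k) x) = \<zero>\<^bsub>P (Suc k)\<^esub>" if "x \<in> carrier (P (Suc (Suc k)))" for x
      using s(2)[OF that] hom_closed[OF d that] by (simp add: a_minus_def PSk.M.r_neg)
    then obtain h where h: "h \<in> left_module_hom A (P k) (P (Suc k))"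
      "\<And>x. x \<in> carrier (P (Suc k)) \<Longrightarrow> h (d k x) = ?\<chi> x"
      using ext_Q[OF _ Pfg Ppr \<chi>] step.hyps pn by auto
    have "d k (h (d k x)) = d k x" if x: "x \<in> carrier (P (Suc k))" for x
    proof -
      have sx: "s x \<in> carrier (P (Suc (Suc k)))" by (rule hom_closed[OF s(1) x])
      have "d k (h (d k x)) = d k (?\<chi> x)" using h(2)[OF x] by simp
      also have "\<dots> = d k x \<ominus>\<^bsub>P k\<^esub> d k (d (Suc k) (s x))"
        by (rule hom_diff[OF P' P' d x hom_closed[OF d sx]])
      also have "\<dots> = d k x" using dd[OF sx] hom_closed[OF d x] by (simp add: a_minus_def)
      finally show ?thesis .
    qed
    with h(1) show ?case by (intro bexI[of _ h] ballI)
  qed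
  then obtain s where s: "s \<in> left_module_hom A (P 0) (P (Suc 0))"
    "\<And>x. x \<in> carrier (P (Suc 0)) \<Longrightarrow> d 0 (s (d 0 x)) = d 0 x"
    by (meson le0)
  interpret P0: left_module A "P 0" by (rule P')
  have "\<epsilon> x = \<zero>\<^bsub>U\<^esub>" if x: "x \<in> carrier (P 0)" for x
  proof -
    have sx: "d 0 (s x) \<in> carrier (P 0)" by (rule hom_closed[OF d hom_closed[OF s(1) x]])
    have "x \<ominus>\<^bsub>P 0\<^esub> d 0 (s x) = \<zero>\<^bsub>P 0\<^esub>"
    proof (rule bottom[OF Pfg Ppr hom_diff_map[OF P' P' hom_ident hom_comp[OF s(1) d]] _ x])
      show "d 0 y \<ominus>\<^bsub>P 0\<^esub> d 0 (s (d 0 y)) = \<zero>\<^bsub>P 0\<^esub>" if "y \<in> carrier (P (Suc 0))" for y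
        using s(2)[OF that] hom_closed[OF d that] by (simp add: a_minus_def P0.M.r_neg)
    qed
    then have "x = d 0 (s x)"
      using x sx by (metis P0.M.a_inv_closed P0.M.minus_equality P0.M.minus_minus a_minus_def)
    moreover have "d 0 (s x) \<in> d 0 ` carrier (P (Suc 0))" using hom_closed[OF s(1) x] by blast
    ultimately have "x \<in> a_kernel (P 0) U \<epsilon>" using d0 by simp
    then show ?thesis by (simp add: a_kernel_def')
  qed
  moreover have "\<zero>\<^bsub>U\<^esub> \<in> carrier U"
    using hom_closed[OF \<epsilon>(1) P0.M.zero_closed] hom_zero[OF P' U \<epsilon>(1)] by simp
  ultimately show ?thesis using \<epsilon>(2) by auto
qed

section \<open>Dimensions\<close>

lemma left_module_isomorphic_sym:
  assumes T: "left_module A T" and U: "left_module A U" and "left_module_isomorphic A T U"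
  shows "left_module_isomorphic A U T"
proof -
  obtain f where f: "f \<in> left_module_hom A T U" "bij_betw f (carrier T) (carrier U)"
    using assms(3) unfolding left_module_isomorphic_def by blast
  have im: "(\<lambda>x. x) ` carrier U \<subseteq> f ` carrier T" using f(2) by (auto simp: bij_betw_def)
  obtain h where h: "h \<in> left_module_hom A U T" "\<And>y. y \<in> carrier U \<Longrightarrow> f (h y) = y"
    using hom_lift_injective[OF T U f(1) bij_betw_imp_inj_on[OF f(2)] hom_ident im U] by auto
  have "h (f x) = x" if "x \<in> carrier T" for x
    using h(2)[of "f x"] hom_closed[OF f(1) that] hom_closed[OF h(1)] that
      inj_onD[OF bij_betw_imp_inj_on[OF f(2)], of "h (f x)" x] by auto
  then have "bij_betw h (carrier U) (carrier T)"
    using h(2) hom_closed[OF h(1)] hom_closed[OF f(1)]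
    by (intro bij_betw_byWitness[where f' = f]) auto
  with h(1) show ?thesis unfolding left_module_isomorphic_def by blast
qed

lemma projective_resolution_transport:
  assumes T: "left_module A T" and U: "left_module A U"
    and f: "f \<in> left_module_hom A T U" "bij_betw f (carrier T) (carrier U)"
    and res: "projective_resolution A T P d \<epsilon>"
  shows "projective_resolution A U P d (\<lambda>x. f (\<epsilon> x))"
proof -
  have \<epsilon>: "\<epsilon> \<in> left_module_hom A (P 0) T" "\<epsilon> ` carrier (P 0) = carrier T"
    using res unfolding projective_resolution_def by auto
  interpret T: left_module A T by fact
  have "f t = \<zero>\<^bsub>U\<^esub> \<longleftrightarrow> t = \<zero>\<^bsub>T\<^esub>" if "t \<in> carrier T" for t
    using hom_zero[OF T U f(1)] inj_onD[OF bij_betw_imp_inj_on[OF f(2)], of t "\<zero>\<^bsub>T\<^esub>"] that by auto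
  then have "a_kernel (P 0) U (\<lambda>x. f (\<epsilon> x)) = a_kernel (P 0) T \<epsilon>"
    unfolding a_kernel_def' using hom_closed[OF \<epsilon>(1)] by auto
  moreover have "(\<lambda>x. f (\<epsilon> x)) ` carrier (P 0) = carrier U"
    using f(2) by (simp add: image_image[symmetric] \<epsilon>(2) bij_betw_def)
  ultimately show ?thesis
    using res hom_comp[OF \<epsilon>(1) f(1)] unfolding projective_resolution_def by simp
qed

lemma projective_dimension_isomorphic:
  assumes T: "left_module A T" and U: "left_module A U" and "left_module_isomorphic A T U"
  shows "projective_dimension A T = projective_dimension A U"
proof -
  obtain f where f: "f \<in> left_module_hom A T U" "bij_betw f (carrier T) (carrier U)"
    using assms(3) unfolding left_module_isomorphic_def by blast
  obtain h where h: "h \<in> left_module_hom A U T" "bij_betw h (carrier U) (carrier T)"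
    using left_module_isomorphic_sym[OF assms] unfolding left_module_isomorphic_def by blast
  have "(\<exists>\<epsilon>. projective_resolution A T P d \<epsilon>) \<longleftrightarrow> (\<exists>\<epsilon>. projective_resolution A U P d \<epsilon>)" for P d
    using projective_resolution_transport[OF T U f] projective_resolution_transport[OF U T h] by meson
  then have "(\<exists>P d \<epsilon>. projective_resolution A T P d \<epsilon> \<and> (\<forall>i>n. carrier (P i) = {\<zero>\<^bsub>P i\<^esub>})) \<longleftrightarrow>
    (\<exists>P d \<epsilon>. projective_resolution A U P d \<epsilon> \<and> (\<forall>i>n. carrier (P i) = {\<zero>\<^bsub>P i\<^esub>}))" for n
    by metis
  then show ?thesis unfolding projective_dimension_def by simp
qed

text \<open>Values in \<^typ>\<open>enat\<close> that all lie strictly below \<open>n\<close> have supremum at most \<open>n - 1\<close>. For positive \<open>n\<close>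
  the lower bound on the supremum is therefore met by an actual coresolution; in particular one exists.\<close>

lemma dominant_dimension_geE:
  assumes "enat n \<le> dominant_dimension A M" and "n > 0"
  obtains I d e where "minimal_injective_coresolution A M I d e" "\<And>j. j < n \<Longrightarrow> projective_module A (I j)"
proof -
  let ?X = "{first_nonprojective A I | I d e. minimal_injective_coresolution A M I d e}"
  have "\<exists>x\<in>?X. enat n \<le> x"
  proof (rule ccontr)
    assume none: "\<not> ?thesis"
    have "x \<le> enat (n - 1)" if "x \<in> ?X" for x
    proof -
      have "x < enat n" using none that by (meson linorder_not_le)
      then show ?thesis using assms(2) by (cases x) auto
    qed
    then have "Sup ?X \<le> enat (n - 1)" by (rule Sup_least)
    moreover have "enat n \<le> Sup ?X" using assms(1) by (simp add: dominant_dimension_def)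
    ultimately have "enat n \<le> enat (n - 1)" by (rule order_trans[rotated])
    then show False using assms(2) by simp
  qed
  then obtain I d e where c: "minimal_injective_coresolution A M I d e" "enat n \<le> first_nonprojective A I"
    by auto
  have "projective_module A (I j)" if "j < n" for j
  proof (rule ccontr)
    assume j: "\<not> projective_module A (I j)"
    then have "first_nonprojective A I = enat (LEAST i. \<not> projective_module A (I i))"
      unfolding first_nonprojective_def by auto
    moreover have "(LEAST i. \<not> projective_module A (I i)) \<le> j" using j by (rule Least_le)
    ultimately show False using c(2) that by simp
  qed
  with c(1) that show thesis by blast
qed

theorem corollary4p7:
  fixes A :: "('a, 'r) ring_scheme" and K :: "'a set"
    and T :: "('a, 'm) module" and g :: nat
  assumes "higher_auslander_algebra K A"
    and "global_dimension A = enat g"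
    and "torsion_module A T"
    and "carrier T \<noteq> {\<zero>\<^bsub>T\<^esub>}"
  shows "projective_dimension A T = enat g"
proof -
  have fd: "finite_dimensional_algebra K A" using assms(1) unfolding higher_auslander_algebra_def by blast
  then have A: "ring A" by (simp add: finite_dimensional_algebra_def)
  obtain n where n: "2 \<le> n" "global_dimension A \<le> enat n"
    "enat n \<le> dominant_dimension A (regular_module A)"
    using assms(1) unfolding higher_auslander_algebra_def by blast
  obtain I \<delta> e where cores: "minimal_injective_coresolution A (regular_module A) I \<delta> e"
    and proj: "\<And>j. j < n \<Longrightarrow> projective_module A (I j)"
    using dominant_dimension_geE[OF n(3)] n(1) by (metis less_le_trans pos2)
  have T: "left_module A T" using assms(3) unfolding torsion_module_def by blast
  obtain M :: "'a umodule" where M: "fg_left_module A M" and TM: "left_module_isomorphic A T (torsion_submodule A M)"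
    using assms(3) unfolding torsion_module_def by blast
  have M': "left_module A M" using M unfolding fg_left_module_def by blast
  let ?U = "torsion_submodule A M"
  have Ufg: "fg_left_module A ?U"
    using submodule_of_fg_is_fg[OF fd M torsion_submodule_is_submodule[OF M']]
    by (simp add: torsion_submodule_eq[symmetric])
  then have U: "left_module A ?U" unfolding fg_left_module_def by blast
  have pd: "projective_dimension A T = projective_dimension A ?U"
    by (rule projective_dimension_isomorphic[OF T U TM])
  have U0: "carrier ?U \<noteq> {\<zero>\<^bsub>?U\<^esub>}"
  proof
    assume U0: "carrier ?U = {\<zero>\<^bsub>?U\<^esub>}"
    obtain h where h: "h \<in> left_module_hom A ?U T" "bij_betw h (carrier ?U) (carrier T)"
      using left_module_isomorphic_sym[OF T U TM] unfolding left_module_isomorphic_def by blast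
    have "carrier T = h ` carrier ?U" using h(2) by (simp add: bij_betw_def)
    also have "\<dots> = {\<zero>\<^bsub>T\<^esub>}" using U0 hom_zero[OF U T h(1)] by simp
    finally show False using assms(4) by simp
  qed
  have I0: "fg_left_module A (I 0)" "injective_module A (I 0)" "projective_module A (I 0)"
    and e: "e \<in> left_module_hom A (regular_module A) (I 0)" "inj_on e (carrier A)"
    using cores proj[of 0] n(1) unfolding minimal_injective_coresolution_def
    by (auto simp: regular_module_simps)
  have "enat n \<le> projective_dimension A ?U"
    unfolding projective_dimension_def
  proof (rule Inf_greatest)
    fix q assume "q \<in> {enat n | n. \<exists>P d e. projective_resolution A ?U P d e \<and>
                        (\<forall>i>n. carrier (P i) = {\<zero>\<^bsub>P i\<^esub>})}"
    then obtain p P d \<epsilon> where q: "q = enat p" "projective_resolution A ?U P d \<epsilon>"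
      "\<And>i. i > p \<Longrightarrow> carrier (P i) = {\<zero>\<^bsub>P i\<^esub>}" by blast
    have "\<not> p < n"
    proof
      assume "p < n"
      have "carrier ?U = {\<zero>\<^bsub>?U\<^esub>}"
      proof (rule resolved_module_zero[OF A U q(2,3) cores proj \<open>p < n\<close>])
        show "f u = \<zero>\<^bsub>Q\<^esub>" if "fg_left_module A Q" "projective_module A Q"
          "f \<in> left_module_hom A ?U Q" "u \<in> carrier ?U" for Q f u
          by (rule hom_from_torsion_to_projective_zero[OF M' I0 e that])
      qed
      with U0 show False by contradiction
    qed
    then show "enat n \<le> q" using q(1) by simp
  qed
  moreover have "projective_dimension A ?U \<le> enat g"
    unfolding assms(2)[symmetric] global_dimension_def using Ufg by (intro Sup_upper) blast
  moreover have "enat g \<le> enat n" using n(2) assms(2) by simp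
  ultimately show ?thesis unfolding pd by (metis order_antisym order_trans)
qed

end
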